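(* Let $V_{14}$ be a $14$-dimensional complex vector space with non-degenerate quadratic form $q$, let $\Delta_{14}$ be a half-spin representation of $\mathrm{Spin}_{14}=\mathrm{Spin}(V_{14},q)$, and let $J_8$ be the (unique up to scalar) non-zero $\mathrm{Spin}_{14}$-invariant homogeneous polynomial of degree $8$ on $\Delta_{14}$. For $z\in\Delta_{14}$ let $M_z=\Theta(\Omega_z)\in \mathrm{End}(V_{14})$, where $\Omega:S^2\Delta_{14}\to\wedge^3V_{14}$ and $\Theta:S^2(\wedge^3V_{14})\to \mathrm{End}(V_{14})$ are the equivariant maps defined in the context, evaluated as quadratic maps (so the entries of $M_z$ are quartic polynomials in $z$). Then the pair $(M,M)$ is a matrix factorization of $J_8$: for a suitable normalization of $J_8$, $$M_z\circ M_z = J_8(z)\,\mathrm{Id}_{V_{14}}\qquad\text{for all } z\in\Delta_{14}.$$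
   Context: A matrix factorization of a polynomial $W$ is a pair $(P,Q)$ of square matrices of the same size $N$ with polynomial entries such that $PQ=QP=W\cdot \mathrm{Id}_N$. Spin representations: write also $q$ for the polar symmetric bilinear form, with $q(v)=q(v,v)$. Choose a splitting $V_{14}=E\oplus F$ with $E,F$ maximal isotropic (of dimension $7$), a basis $e_1,\dots,e_7$ of $E$ and the dual basis $f_1,\dots,f_7$ of $F$, $q(e_i,f_j)=\delta_{ij}$. The Clifford algebra of $V_{14}$ acts on $\wedge^*E$: $E$ acts by wedge product and $F$ by twice the contraction defined by $q$ (so $v\cdot v=q(v)$). Put $\Delta_{14}=\wedge^{+}E$ (even part); its dual $\Delta_{14}^\vee$ is identified with $\wedge^{-}E$ (odd part) by the $\mathrm{Spin}_{14}$-invariant pairing $\langle z,z'\rangle$ = component of $\tau(z)\wedge z'$ in $\wedge^7E\simeq\mathbb{C}$, where $\tau$ is the reversal anti-automorphism of $\wedge^*E$ ($\tau=(-1)^{k(k-1)/2}$ on $\wedge^kE$). Clifford multiplication gives maps $V_{14}\otimes\Delta_{14}\to\Delta_{14}^\vee$ and $V_{14}\otimes\Delta_{14}^\vee\to\Delta_{14}$. Definition of $\Omega$: composing three Clifford multiplications after the inclusion $\wedge^3V_{14}\subset V_{14}^{\otimes 3}$ as skew-symmetric tensors gives an equivariant map $\wedge^3V_{14}\otimes\Delta_{14}\to\Delta_{14}^\vee$; its transpose (using $q$ to identify $\wedge^3V_{14}$ with its dual) is $\Omega:S^2\Delta_{14}\to\wedge^3V_{14}$. Concretely, for a basis $(v_i)$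 of $V_{14}$ with $q$-dual basis $(w_i)$, $\Omega_z=\sum_{i<j<k}\langle z,v_iv_jv_kz\rangle\, w_i\wedge w_j\wedge w_k$, where $v_iv_jv_k$ denotes the skew-symmetrized Clifford product. Definition of $\Theta$: embed $\wedge^3V_{14}$ in $V_{14}\otimes\wedge^2V_{14}$ by polarization, $u\wedge v\wedge w\mapsto u\otimes (v\wedge w)+v\otimes (w\wedge u)+w\otimes (u\wedge v)$. Let $q_2$ be the quadratic form on $\wedge^2V_{14}$ with polarization $q_2(u_1\wedge u_2,v_1\wedge v_2)=\det(q(u_i,v_j))_{1\le i,j\le 2}$. If $\omega\in\wedge^3V_{14}$ has polarization $\sum_i v_i\otimes\omega_i$, then $\Theta(\omega)=\sum_{i,j}q_2(\omega_i,\omega_j)\,v_i\otimes v_j\in S^2V_{14}\subset V_{14}\otimes V_{14}\simeq \mathrm{End}(V_{14})$, the last identification being via $q$. *)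

theory Defs
  imports Complex_Main "Jordan_Normal_Form.Matrix"
begin

text \<open>
  The exterior algebra of a space with ordered basis \<open>b\<^sub>0, b\<^sub>1, \<dots>\<close> is modelled by coordinate
  functions \<open>x :: nat set \<Rightarrow> complex\<close>; \<open>x S\<close> is the coefficient of
  \<open>b\<^bsub>s1\<^esub> \<and> \<dots> \<and> b\<^bsub>sk\<^esub>\<close>, where \<open>S = {s1 < \<dots> < sk}\<close>.  The model is used for \<open>\<wedge>\<^sup>*E\<close>
  (indices below 7) and for \<open>\<wedge>\<^sup>*V\<close> (indices below 14).
\<close>

definition ext_vec :: "nat \<Rightarrow> (nat \<Rightarrow> complex) \<Rightarrow> nat set \<Rightarrow> complex" where
  "ext_vec n c S = (\<Sum>i<n. if S = {i} then c i else 0)"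

definition wedge :: "(nat set \<Rightarrow> complex) \<Rightarrow> (nat set \<Rightarrow> complex) \<Rightarrow> nat set \<Rightarrow> complex" where
  "wedge x y S =
     (\<Sum>A\<in>Pow S. (-1) ^ card {(a, b). a \<in> A \<and> b \<in> S - A \<and> b < a} * x A * y (S - A))"

definition reversal :: "(nat set \<Rightarrow> complex) \<Rightarrow> nat set \<Rightarrow> complex" where
  "reversal x S = (-1) ^ (card S * (card S - 1) div 2) * x S"

definition spin_coords :: "nat set set" where
  "spin_coords = {S. S \<subseteq> {..<7} \<and> even (card S)}"

definition half_spin :: "(nat set \<Rightarrow> complex) set" where
  "half_spin = {z. \<forall>S. S \<notin> spin_coords \<longrightarrow> z S = 0}"

text \<open>The invariant pairing between even and odd spinors, with \<open>\<wedge>\<^sup>7E\<close> identified with the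
  scalars by \<open>e\<^sub>0 \<and> \<dots> \<and> e\<^sub>6 \<mapsto> 1\<close>.\<close>

definition spin_pairing :: "(nat set \<Rightarrow> complex) \<Rightarrow> (nat set \<Rightarrow> complex) \<Rightarrow> complex" where
  "spin_pairing z z' = wedge (reversal z) z' {..<7}"

text \<open>Polynomials on \<open>\<Delta>\<close> are represented by the functions they induce on \<open>\<Delta>\<close>, which determine
  them because the ground field is infinite.  An exponent vector \<open>\<alpha>\<close> only matters on
  \<open>spin_coords\<close>.\<close>

definition polynomial_on_half_spin :: "((nat set \<Rightarrow> complex) \<Rightarrow> complex) \<Rightarrow> bool" where
  "polynomial_on_half_spin P \<longleftrightarrow>
     (\<exists>(A :: (nat set \<Rightarrow> nat) set) c. finite A \<and>
        (\<forall>z\<in>half_spin. P z = (\<Sum>\<alpha>\<in>A. c \<alpha> * (\<Prod>S\<in>spin_coords. z S ^ \<alpha> S))))"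

definition homogeneous_on_half_spin :: "nat \<Rightarrow> ((nat set \<Rightarrow> complex) \<Rightarrow> complex) \<Rightarrow> bool" where
  "homogeneous_on_half_spin d P \<longleftrightarrow>
     (\<exists>(A :: (nat set \<Rightarrow> nat) set) c. finite A \<and>
        (\<forall>\<alpha>\<in>A. (\<Sum>S\<in>spin_coords. \<alpha> S) = d) \<and>
        (\<forall>z\<in>half_spin. P z = (\<Sum>\<alpha>\<in>A. c \<alpha> * (\<Prod>S\<in>spin_coords. z S ^ \<alpha> S))))"

definition matrix_factorization ::
  "nat \<Rightarrow> ((nat set \<Rightarrow> complex) \<Rightarrow> complex mat) \<Rightarrow> ((nat set \<Rightarrow> complex) \<Rightarrow> complex mat)
     \<Rightarrow> ((nat set \<Rightarrow> complex) \<Rightarrow> complex) \<Rightarrow> bool" where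
  "matrix_factorization N P Q W \<longleftrightarrow>
     polynomial_on_half_spin W \<and>
     (\<forall>z. P z \<in> carrier_mat N N \<and> Q z \<in> carrier_mat N N) \<and>
     (\<forall>i<N. \<forall>j<N. polynomial_on_half_spin (\<lambda>z. P z $$ (i, j)) \<and>
                   polynomial_on_half_spin (\<lambda>z. Q z $$ (i, j))) \<and>
     (\<forall>z\<in>half_spin. P z * Q z = W z \<cdot>\<^sub>m 1\<^sub>m N \<and> Q z * P z = W z \<cdot>\<^sub>m 1\<^sub>m N)"

text \<open>The spans \<open>E\<close>, \<open>F\<close> of the \<open>e\<^sub>i\<close> and of the \<open>f\<^sub>i\<close> are maximal isotropic and \<open>V = E \<oplus> F\<close>:
  the relations below force the fourteen vectors to be independent, hence a basis.\<close>

locale split_quadratic_space_14 = vector_space scale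
  for scale :: "complex \<Rightarrow> 'v::ab_group_add \<Rightarrow> 'v" (infixr "*s" 75) +
  fixes q :: "'v \<Rightarrow> 'v \<Rightarrow> complex"
    and e f :: "nat \<Rightarrow> 'v"
  assumes dim_14: "dim UNIV = 14"
    and q_sym: "q u v = q v u"
    and q_add: "q (u + u') v = q u v + q u' v"
    and q_scale: "q (c *s u) v = c * q u v"
    and q_nondegenerate: "(\<And>v. q u v = 0) \<Longrightarrow> u = 0"
    and e_isotropic: "i < 7 \<Longrightarrow> j < 7 \<Longrightarrow> q (e i) (e j) = 0"
    and f_isotropic: "i < 7 \<Longrightarrow> j < 7 \<Longrightarrow> q (f i) (f j) = 0"
    and e_f_dual: "i < 7 \<Longrightarrow> j < 7 \<Longrightarrow> q (e i) (f j) = (if i = j then 1 else 0)"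
begin

text \<open>Clifford multiplication on \<open>\<wedge>\<^sup>*E\<close>.  For \<open>u = u\<^sub>E + u\<^sub>F\<close>, the coordinates of \<open>u\<^sub>E\<close> are the
  \<open>q u (f i)\<close>, and contraction by \<open>u\<close> only depends on \<open>u\<^sub>F\<close> since \<open>q (u\<^sub>E) (e i) = 0\<close>.\<close>

definition contraction :: "'v \<Rightarrow> (nat set \<Rightarrow> complex) \<Rightarrow> nat set \<Rightarrow> complex" where
  "contraction u x T =
     (\<Sum>i\<in>{..<7} - T. (-1) ^ card {j\<in>T. j < i} * q u (e i) * x (insert i T))"

definition clifford :: "'v \<Rightarrow> (nat set \<Rightarrow> complex) \<Rightarrow> nat set \<Rightarrow> complex" where
  "clifford u x = (\<lambda>S. wedge (ext_vec 7 (\<lambda>i. q u (f i))) x S + 2 * contraction u x S)"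

text \<open>\<open>Spin\<close> consists of the products of an even number of vectors \<open>u\<close> with \<open>q(u) = 1\<close> in the
  Clifford algebra.  The latter is identified with \<open>End(\<wedge>\<^sup>*E)\<close> by its action, which is faithful
  because \<open>V\<close> is even-dimensional.\<close>

inductive_set spin_group :: "((nat set \<Rightarrow> complex) \<Rightarrow> nat set \<Rightarrow> complex) set" where
  spin_id: "id \<in> spin_group"
| spin_mult: "g \<in> spin_group \<Longrightarrow> q u u = 1 \<Longrightarrow> q v v = 1
    \<Longrightarrow> clifford u \<circ> clifford v \<circ> g \<in> spin_group"

definition invariant_octic :: "((nat set \<Rightarrow> complex) \<Rightarrow> complex) \<Rightarrow> bool" where
  "invariant_octic J \<longleftrightarrow>
     homogeneous_on_half_spin 8 J \<and>
     (\<exists>z\<in>half_spin. J z \<noteq> 0) \<and>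
     (\<forall>g\<in>spin_group. \<forall>z\<in>half_spin. J (g z) = J z)"

text \<open>A basis of \<open>V\<close> and its \<open>q\<close>-dual basis; the coordinates of \<open>u\<close> in the former are
  \<open>q u (dual_vec i)\<close>.\<close>

definition basis_vec :: "nat \<Rightarrow> 'v" where
  "basis_vec i = (if i < 7 then e i else f (i - 7))"

definition dual_vec :: "nat \<Rightarrow> 'v" where
  "dual_vec i = (if i < 7 then f i else e (i - 7))"

definition vec_in_ext :: "'v \<Rightarrow> nat set \<Rightarrow> complex" where
  "vec_in_ext u = ext_vec 14 (\<lambda>i. q u (dual_vec i))"

definition skew_clifford ::
  "'v \<Rightarrow> 'v \<Rightarrow> 'v \<Rightarrow> (nat set \<Rightarrow> complex) \<Rightarrow> nat set \<Rightarrow> complex" where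
  "skew_clifford u v w x = (\<lambda>S. 1 / 6 *
     (clifford u (clifford v (clifford w x)) S
    + clifford v (clifford w (clifford u x)) S
    + clifford w (clifford u (clifford v x)) S
    - clifford v (clifford u (clifford w x)) S
    - clifford u (clifford w (clifford v x)) S
    - clifford w (clifford v (clifford u x)) S))"

definition Omega :: "(nat set \<Rightarrow> complex) \<Rightarrow> nat set \<Rightarrow> complex" where
  "Omega z = (\<lambda>S. \<Sum>k<14. \<Sum>j<k. \<Sum>i<j.
     spin_pairing z (skew_clifford (basis_vec i) (basis_vec j) (basis_vec k) z) *
     wedge (vec_in_ext (dual_vec i))
       (wedge (vec_in_ext (dual_vec j)) (vec_in_ext (dual_vec k))) S)"

text \<open>\<open>V \<otimes> \<wedge>\<^sup>2V\<close> is modelled by functions \<open>t :: nat \<Rightarrow> nat set \<Rightarrow> complex\<close>, standing for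
  \<open>\<Sum>i<14. basis_vec i \<otimes> t i\<close>.\<close>

definition vec_tensor :: "'v \<Rightarrow> (nat set \<Rightarrow> complex) \<Rightarrow> nat \<Rightarrow> nat set \<Rightarrow> complex" where
  "vec_tensor u \<eta> i S = q u (dual_vec i) * \<eta> S"

definition polarize_wedge :: "'v \<Rightarrow> 'v \<Rightarrow> 'v \<Rightarrow> nat \<Rightarrow> nat set \<Rightarrow> complex" where
  "polarize_wedge u v w = (\<lambda>i S.
     vec_tensor u (wedge (vec_in_ext v) (vec_in_ext w)) i S
   + vec_tensor v (wedge (vec_in_ext w) (vec_in_ext u)) i S
   + vec_tensor w (wedge (vec_in_ext u) (vec_in_ext v)) i S)"

definition polarization :: "(nat set \<Rightarrow> complex) \<Rightarrow> nat \<Rightarrow> nat set \<Rightarrow> complex" where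
  "polarization \<omega> = (\<lambda>l S. \<Sum>k<14. \<Sum>j<k. \<Sum>i<j.
     \<omega> {i, j, k} * polarize_wedge (basis_vec i) (basis_vec j) (basis_vec k) l S)"

definition q2 :: "(nat set \<Rightarrow> complex) \<Rightarrow> (nat set \<Rightarrow> complex) \<Rightarrow> complex" where
  "q2 \<eta> \<theta> = (\<Sum>b<14. \<Sum>a<b. \<Sum>d<14. \<Sum>c<d. \<eta> {a, b} * \<theta> {c, d} *
     (q (basis_vec a) (basis_vec c) * q (basis_vec b) (basis_vec d)
    - q (basis_vec a) (basis_vec d) * q (basis_vec b) (basis_vec c)))"

text \<open>\<open>u \<otimes> v\<close> is identified with the endomorphism \<open>x \<mapsto> q(v, x) u\<close>.\<close>

definition Theta :: "(nat set \<Rightarrow> complex) \<Rightarrow> 'v \<Rightarrow> 'v" where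
  "Theta \<omega> x = (\<Sum>i<14. \<Sum>j<14.
     (q2 (polarization \<omega> i) (polarization \<omega> j) * q (basis_vec j) x) *s basis_vec i)"

definition M_endo :: "(nat set \<Rightarrow> complex) \<Rightarrow> 'v \<Rightarrow> 'v" where
  "M_endo z = Theta (Omega z)"

definition M_mat :: "(nat set \<Rightarrow> complex) \<Rightarrow> complex mat" where
  "M_mat z = mat 14 14 (\<lambda>(i, j). q (M_endo z (basis_vec j)) (dual_vec i))"

end

end

theory Submission
  imports Defs
begin

text \<open>
  The half-spin representation is prehomogeneous: the group generated by \<open>Spin\<close> and the scalars
  has a dense orbit, that of \<open>z\<^sub>0 = 1 + e\<^sub>0e\<^sub>1e\<^sub>2e\<^sub>6 + e\<^sub>3e\<^sub>4e\<^sub>5e\<^sub>6 + e\<^sub>0e\<^sub>1e\<^sub>2e\<^sub>3e\<^sub>4e\<^sub>5\<close>.  Density is only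
  needed in the form that a polynomial vanishing on the orbit is zero.  The orbit contains, through
  each of its points, lines whose directions span \<open>\<Delta>\<close>; hence the derivatives of such a polynomial
  vanish on the orbit too, and one inducts on the degree.  By equivariance of \<open>z \<mapsto> M\<^sub>z\<close> under
  reflections, it suffices to check that \<open>M\<^sub>z M\<^sub>z\<close> is a scalar for \<open>z = z\<^sub>0\<close>, which is a finite
  computation, and \<open>J\<^sub>8(z) = tr (M\<^sub>z M\<^sub>z) / 14\<close>.  Uniqueness of \<open>J\<^sub>8\<close> is again density of the orbit.
\<close>

text \<open>The orbit is given only by finite products of unit vectors and scalars, so tangent
  directions must come from explicit curves inside it. Straight lines are used because a polynomial
  then restricts to a function of one variable that vanishes near 0, and no differential calculus on
  the group is needed. Root vectors yield lines because they square to zero, Cartan elements yield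
  lines after a rescaling, and scaling yields the direction of the point itself. The spanning
  property is checked at \<open>base_spinor\<close> alone; the linear maps generating the orbit
  carry it to every other point.

  That M_z M_z is a scalar is encoded by the polynomials \<open>defect u v\<close>. They are not
  invariant: a reflection moves \<open>u\<close> and \<open>v\<close>. A single unit vector also
  exchanges even and odd spinors, so all forms are defined and studied on the whole of \<wedge>E and
  restricted to \<open>half_spin\<close> only at the end.

  At \<open>base_spinor\<close> the endomorphism has eigenvalues 48 and -48, each on a 7-dimensional
  space; this is the origin of 2304 = 48^2.\<close>

lemma half_spin_comb:
  "z \<in> half_spin \<Longrightarrow> v \<in> half_spin \<Longrightarrow> (\<lambda>S. z S + t * v S) \<in> half_spin"
  by (simp add: half_spin_def)

lemma half_spin_scale: "z \<in> half_spin \<Longrightarrow> (\<lambda>S. t * z S) \<in> half_spin"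
  by (simp add: half_spin_def)

lemma finite_spin_coords: "finite spin_coords"
  by (rule finite_subset[of _ "Pow {..<7}"]) (auto simp: spin_coords_def)

section \<open>Polynomial functions\<close>

lemma homogeneous_cong:
  assumes "homogeneous_on_half_spin d P" "\<And>z. z \<in> half_spin \<Longrightarrow> P z = Q z"
  shows "homogeneous_on_half_spin d Q"
  using assms unfolding homogeneous_on_half_spin_def by metis

lemma homogeneous_imp_polynomial:
  "homogeneous_on_half_spin d P \<Longrightarrow> polynomial_on_half_spin P"
  unfolding homogeneous_on_half_spin_def polynomial_on_half_spin_def by metis

lemma homogeneous_zero: "homogeneous_on_half_spin d (\<lambda>z. 0)"
  unfolding homogeneous_on_half_spin_def by (rule exI[of _ "{}"]) simp

lemma homogeneous_coord: "homogeneous_on_half_spin 1 (\<lambda>z. z S)"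
proof (cases "S \<in> spin_coords")
  case True
  define \<alpha> :: "nat set \<Rightarrow> nat" where "\<alpha> = (\<lambda>T. if T = S then 1 else 0)"
  have "(\<Prod>T\<in>spin_coords. z T ^ \<alpha> T) = z S" for z :: "nat set \<Rightarrow> complex"
  proof -
    have "(\<Prod>T\<in>spin_coords. z T ^ \<alpha> T) = (\<Prod>T\<in>spin_coords. if T = S then z T else 1)"
      by (rule prod.cong) (auto simp: \<alpha>_def)
    also have "\<dots> = z S" using True by (simp add: prod.delta finite_spin_coords)
    finally show ?thesis .
  qed
  moreover have "(\<Sum>T\<in>spin_coords. \<alpha> T) = 1"
    using True by (simp add: \<alpha>_def finite_spin_coords)
  ultimately show ?thesis unfolding homogeneous_on_half_spin_def
    by (intro exI[of _ "{\<alpha>}"] exI[of _ "\<lambda>_. 1"]) simp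
next
  \<comment> \<open>Such a coordinate vanishes on \<open>half_spin\<close>, and the zero function is
    homogeneous of every degree through the empty sum.\<close>
  case False
  show ?thesis
    by (rule homogeneous_cong[OF homogeneous_zero]) (use False in \<open>auto simp: half_spin_def\<close>)
qed

lemma homogeneous_add:
  assumes "homogeneous_on_half_spin d P" "homogeneous_on_half_spin d Q"
  shows "homogeneous_on_half_spin d (\<lambda>z. P z + Q z)"
proof -
  obtain A :: "(nat set \<Rightarrow> nat) set" and a where A: "finite A" "\<forall>\<alpha>\<in>A. sum \<alpha> spin_coords = d"
    "\<forall>z\<in>half_spin. P z = (\<Sum>\<alpha>\<in>A. a \<alpha> * (\<Prod>S\<in>spin_coords. z S ^ \<alpha> S))"
    using assms(1) unfolding homogeneous_on_half_spin_def by metis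
  obtain B :: "(nat set \<Rightarrow> nat) set" and b where B: "finite B" "\<forall>\<alpha>\<in>B. sum \<alpha> spin_coords = d"
    "\<forall>z\<in>half_spin. Q z = (\<Sum>\<alpha>\<in>B. b \<alpha> * (\<Prod>S\<in>spin_coords. z S ^ \<alpha> S))"
    using assms(2) unfolding homogeneous_on_half_spin_def by metis
  define c where "c \<alpha> = (if \<alpha> \<in> A then a \<alpha> else 0) + (if \<alpha> \<in> B then b \<alpha> else 0)" for \<alpha>
  have "(\<Sum>\<alpha>\<in>A \<union> B. c \<alpha> * m \<alpha>) = (\<Sum>\<alpha>\<in>A. a \<alpha> * m \<alpha>) + (\<Sum>\<alpha>\<in>B. b \<alpha> * m \<alpha>)" for m
  proof -
    have "(\<Sum>\<alpha>\<in>A \<union> B. c \<alpha> * m \<alpha>)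
        = (\<Sum>\<alpha>\<in>A \<union> B. if \<alpha> \<in> A then a \<alpha> * m \<alpha> else 0) + (\<Sum>\<alpha>\<in>A \<union> B. if \<alpha> \<in> B then b \<alpha> * m \<alpha> else 0)"
      unfolding sum.distrib[symmetric] by (rule sum.cong) (auto simp: c_def algebra_simps)
    also have "(\<Sum>\<alpha>\<in>A \<union> B. if \<alpha> \<in> A then a \<alpha> * m \<alpha> else 0) = (\<Sum>\<alpha>\<in>A. a \<alpha> * m \<alpha>)"
      by (rule sum.mono_neutral_cong_right) (use A B in auto)
    also have "(\<Sum>\<alpha>\<in>A \<union> B. if \<alpha> \<in> B then b \<alpha> * m \<alpha> else 0) = (\<Sum>\<alpha>\<in>B. b \<alpha> * m \<alpha>)"
      by (rule sum.mono_neutral_cong_right) (use A B in auto)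
    finally show ?thesis .
  qed
  then show ?thesis using A B unfolding homogeneous_on_half_spin_def
    by (intro exI[of _ "A \<union> B"] exI[of _ c]) auto
qed

lemma homogeneous_mult:
  assumes "homogeneous_on_half_spin d P" "homogeneous_on_half_spin d' Q"
  shows "homogeneous_on_half_spin (d + d') (\<lambda>z. P z * Q z)"
proof -
  obtain A :: "(nat set \<Rightarrow> nat) set" and a where A: "finite A" "\<forall>\<alpha>\<in>A. sum \<alpha> spin_coords = d"
    "\<forall>z\<in>half_spin. P z = (\<Sum>\<alpha>\<in>A. a \<alpha> * (\<Prod>S\<in>spin_coords. z S ^ \<alpha> S))"
    using assms(1) unfolding homogeneous_on_half_spin_def by metis
  obtain B :: "(nat set \<Rightarrow> nat) set" and b where B: "finite B" "\<forall>\<alpha>\<in>B. sum \<alpha> spin_coords = d'"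
    "\<forall>z\<in>half_spin. Q z = (\<Sum>\<alpha>\<in>B. b \<alpha> * (\<Prod>S\<in>spin_coords. z S ^ \<alpha> S))"
    using assms(2) unfolding homogeneous_on_half_spin_def by metis
  define h :: "(nat set \<Rightarrow> nat) \<times> (nat set \<Rightarrow> nat) \<Rightarrow> nat set \<Rightarrow> nat"
    where "h = (\<lambda>(\<alpha>, \<beta>) S. \<alpha> S + \<beta> S)"
  \<comment> \<open>Different pairs can have the same exponent sum, so a coefficient collects a
    whole fibre of \<open>h\<close>.\<close>
  define c where "c \<gamma> = (\<Sum>p | p \<in> A \<times> B \<and> h p = \<gamma>. a (fst p) * b (snd p))" for \<gamma>
  have "P z * Q z = (\<Sum>\<gamma>\<in>h ` (A \<times> B). c \<gamma> * (\<Prod>S\<in>spin_coords. z S ^ \<gamma> S))"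
    if z: "z \<in> half_spin" for z
  proof -
    have "P z * Q z = (\<Sum>p\<in>A \<times> B. a (fst p) * b (snd p) * (\<Prod>S\<in>spin_coords. z S ^ h p S))"
    proof -
      have "P z * Q z = (\<Sum>p\<in>A \<times> B. (a (fst p) * (\<Prod>S\<in>spin_coords. z S ^ fst p S))
          * (b (snd p) * (\<Prod>S\<in>spin_coords. z S ^ snd p S)))"
        using A(3) B(3) z by (simp only: sum_product sum.cartesian_product split_def)
      also have "\<dots> = (\<Sum>p\<in>A \<times> B. a (fst p) * b (snd p) * (\<Prod>S\<in>spin_coords. z S ^ h p S))"
        by (rule sum.cong) (simp_all add: h_def case_prod_beta power_add prod.distrib)
      finally show ?thesis .
    qed
    also have "\<dots> = (\<Sum>\<gamma>\<in>h ` (A \<times> B). \<Sum>p | p \<in> A \<times> B \<and> h p = \<gamma>.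
        a (fst p) * b (snd p) * (\<Prod>S\<in>spin_coords. z S ^ h p S))"
      by (rule sum.image_gen) (use A B in auto)
    also have "\<dots> = (\<Sum>\<gamma>\<in>h ` (A \<times> B). c \<gamma> * (\<Prod>S\<in>spin_coords. z S ^ \<gamma> S))"
      unfolding c_def sum_distrib_right by (intro sum.cong refl) auto
    finally show ?thesis .
  qed
  moreover have "\<forall>\<gamma>\<in>h ` (A \<times> B). sum \<gamma> spin_coords = d + d'"
    using A B by (auto simp: h_def sum.distrib)
  ultimately show ?thesis using A B unfolding homogeneous_on_half_spin_def
    by (intro exI[of _ "h ` (A \<times> B)"] exI[of _ c]) auto
qed

lemma homogeneous_const: "homogeneous_on_half_spin 0 (\<lambda>z. k)"
  unfolding homogeneous_on_half_spin_def
  by (intro exI[of _ "{\<lambda>_. 0}"] exI[of _ "\<lambda>_. k"]) simp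

lemma homogeneous_cmult:
  "homogeneous_on_half_spin d P \<Longrightarrow> homogeneous_on_half_spin d (\<lambda>z. k * P z)"
  using homogeneous_mult[OF homogeneous_const] by fastforce

lemma homogeneous_sum:
  assumes "\<And>i. i \<in> I \<Longrightarrow> homogeneous_on_half_spin d (P i)"
  shows "homogeneous_on_half_spin d (\<lambda>z. \<Sum>i\<in>I. P i z)"
  using assms by (induction I rule: infinite_finite_induct)
    (auto intro: homogeneous_zero homogeneous_add)

lemma homogeneous_scale:
  assumes "homogeneous_on_half_spin d P" "z \<in> half_spin"
  shows "P (\<lambda>S. k * z S) = k ^ d * P z"
proof -
  obtain A :: "(nat set \<Rightarrow> nat) set" and a where A: "finite A" "\<forall>\<alpha>\<in>A. sum \<alpha> spin_coords = d"
    "\<forall>z\<in>half_spin. P z = (\<Sum>\<alpha>\<in>A. a \<alpha> * (\<Prod>S\<in>spin_coords. z S ^ \<alpha> S))"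
    using assms(1) unfolding homogeneous_on_half_spin_def by metis
  have "P (\<lambda>S. k * z S) = (\<Sum>\<alpha>\<in>A. a \<alpha> * (\<Prod>S\<in>spin_coords. (k * z S) ^ \<alpha> S))"
    using A half_spin_scale[OF assms(2), of k] by auto
  also have "\<dots> = (\<Sum>\<alpha>\<in>A. k ^ d * (a \<alpha> * (\<Prod>S\<in>spin_coords. z S ^ \<alpha> S)))"
  proof (rule sum.cong)
    fix \<alpha> assume "\<alpha> \<in> A"
    then have "(\<Prod>S\<in>spin_coords. k ^ \<alpha> S) = k ^ d"
      using A by (simp add: power_sum[symmetric])
    then show "a \<alpha> * (\<Prod>S\<in>spin_coords. (k * z S) ^ \<alpha> S)
      = k ^ d * (a \<alpha> * (\<Prod>S\<in>spin_coords. z S ^ \<alpha> S))"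
      by (simp add: power_mult_distrib prod.distrib)
  qed simp
  also have "\<dots> = k ^ d * P z"
    using A assms(2) by (simp add: sum_distrib_left)
  finally show ?thesis .
qed

text \<open>Polynomiality is used only through the vanishing of iterated directional derivatives:
  \<open>degree_below d P\<close> means that \<open>P\<close> has degree below \<open>d\<close>.\<close>

primrec degree_below :: "nat \<Rightarrow> ((nat set \<Rightarrow> complex) \<Rightarrow> complex) \<Rightarrow> bool" where
  "degree_below 0 P \<longleftrightarrow> (\<forall>z\<in>half_spin. P z = 0)"
| "degree_below (Suc d) P \<longleftrightarrow> (\<exists>D.
     (\<forall>v\<in>half_spin. degree_below d (D v)) \<and>
     (\<forall>v\<in>half_spin. \<forall>z\<in>half_spin.
        ((\<lambda>t. P (\<lambda>S. z S + t * v S)) has_field_derivative D v z) (at 0)) \<and>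
     (\<forall>v\<in>half_spin. \<forall>w\<in>half_spin. \<forall>z\<in>half_spin. \<forall>k.
        D (\<lambda>S. v S + k * w S) z = D v z + k * D w z))"

lemma degree_belowI:
  assumes "\<And>v. v \<in> half_spin \<Longrightarrow> degree_below d (D v)"
    and "\<And>v z. v \<in> half_spin \<Longrightarrow> z \<in> half_spin \<Longrightarrow>
      ((\<lambda>t. P (\<lambda>S. z S + t * v S)) has_field_derivative D v z) (at 0)"
    and "\<And>v w z k. v \<in> half_spin \<Longrightarrow> w \<in> half_spin \<Longrightarrow> z \<in> half_spin \<Longrightarrow>
      D (\<lambda>S. v S + k * w S) z = D v z + k * D w z"
  shows "degree_below (Suc d) P"
  unfolding degree_below.simps by (intro exI[of _ D] conjI ballI allI) (use assms in blast)+

lemma degree_belowE: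
  assumes "degree_below (Suc d) P"
  obtains D where "\<And>v. v \<in> half_spin \<Longrightarrow> degree_below d (D v)"
    and "\<And>v z. v \<in> half_spin \<Longrightarrow> z \<in> half_spin \<Longrightarrow>
      ((\<lambda>t. P (\<lambda>S. z S + t * v S)) has_field_derivative D v z) (at 0)"
    and "\<And>v w z k. v \<in> half_spin \<Longrightarrow> w \<in> half_spin \<Longrightarrow> z \<in> half_spin \<Longrightarrow>
      D (\<lambda>S. v S + k * w S) z = D v z + k * D w z"
  using assms unfolding degree_below.simps
proof (elim exE conjE)
  fix D
  assume D: "\<forall>v\<in>half_spin. degree_below d (D v)"
    "\<forall>v\<in>half_spin. \<forall>z\<in>half_spin.
      ((\<lambda>t. P (\<lambda>S. z S + t * v S)) has_field_derivative D v z) (at 0)"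
    "\<forall>v\<in>half_spin. \<forall>w\<in>half_spin. \<forall>z\<in>half_spin. \<forall>k.
      D (\<lambda>S. v S + k * w S) z = D v z + k * D w z"
  show thesis by (rule that[of D]) (use D in blast)+
qed

lemma degree_below_zero: "degree_below d (\<lambda>z. 0)"
proof (induction d)
  case 0
  show ?case by simp
next
  case (Suc d)
  show ?case by (rule degree_belowI[where D = "\<lambda>v z. 0"]) (rule Suc.IH | rule DERIV_const | simp)+
qed

lemma degree_below_cong:
  assumes "degree_below d P" "\<And>z. z \<in> half_spin \<Longrightarrow> P z = Q z"
  shows "degree_below d Q"
proof (cases d)
  case (Suc d')
  obtain D where D: "\<And>v. v \<in> half_spin \<Longrightarrow> degree_below d' (D v)"
    "\<And>v z. v \<in> half_spin \<Longrightarrow> z \<in> half_spin \<Longrightarrow>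
      ((\<lambda>t. P (\<lambda>S. z S + t * v S)) has_field_derivative D v z) (at 0)"
    "\<And>v w z k. v \<in> half_spin \<Longrightarrow> w \<in> half_spin \<Longrightarrow> z \<in> half_spin \<Longrightarrow>
      D (\<lambda>S. v S + k * w S) z = D v z + k * D w z"
    using assms(1) Suc degree_belowE by blast
  have "(\<lambda>t. P (\<lambda>S. z S + t * v S)) = (\<lambda>t. Q (\<lambda>S. z S + t * v S))"
    if "v \<in> half_spin" "z \<in> half_spin" for v z
    using that assms(2) half_spin_comb by auto
  then show ?thesis unfolding Suc using D by (intro degree_belowI[where D = D]) auto
qed (use assms in auto)

lemma degree_below_Suc: "degree_below d P \<Longrightarrow> degree_below (Suc d) P"
proof (induction d arbitrary: P)
  case 0
  then show ?case by (intro degree_below_cong[OF degree_below_zero]) auto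
next
  case (Suc d)
  from degree_belowE[OF Suc.prems] obtain D where D: "\<And>v. v \<in> half_spin \<Longrightarrow> degree_below d (D v)"
    "\<And>v z. v \<in> half_spin \<Longrightarrow> z \<in> half_spin \<Longrightarrow>
      ((\<lambda>t. P (\<lambda>S. z S + t * v S)) has_field_derivative D v z) (at 0)"
    "\<And>v w z k. v \<in> half_spin \<Longrightarrow> w \<in> half_spin \<Longrightarrow> z \<in> half_spin \<Longrightarrow>
      D (\<lambda>S. v S + k * w S) z = D v z + k * D w z" by blast
  show ?case by (rule degree_belowI[where D = D]) (use D Suc.IH in auto)
qed

lemma degree_below_mono: "degree_below d P \<Longrightarrow> d \<le> d' \<Longrightarrow> degree_below d' P"
  by (induction d' rule: nat_induct) (auto simp: le_Suc_eq intro: degree_below_Suc simp del: degree_below.simps)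

lemma degree_below_const: "degree_below (Suc d) (\<lambda>z. k)"
  by (rule degree_belowI[where D = "\<lambda>v z. 0"]) (rule degree_below_zero | rule DERIV_const | simp)+

lemma degree_below_coord: "degree_below 2 (\<lambda>z. z S)"
  unfolding numeral_2_eq_2
  by (rule degree_belowI[where D = "\<lambda>v z. v S"], rule degree_below_const) (auto intro!: derivative_eq_intros)

lemma degree_below_add: "degree_below d P \<Longrightarrow> degree_below d Q \<Longrightarrow> degree_below d (\<lambda>z. P z + Q z)"
proof (induction d arbitrary: P Q)
  case (Suc d)
  from degree_belowE[OF Suc.prems(1)] obtain D where D: "\<And>v. v \<in> half_spin \<Longrightarrow> degree_below d (D v)"
    "\<And>v z. v \<in> half_spin \<Longrightarrow> z \<in> half_spin \<Longrightarrow>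
      ((\<lambda>t. P (\<lambda>S. z S + t * v S)) has_field_derivative D v z) (at 0)"
    "\<And>v w z k. v \<in> half_spin \<Longrightarrow> w \<in> half_spin \<Longrightarrow> z \<in> half_spin \<Longrightarrow>
      D (\<lambda>S. v S + k * w S) z = D v z + k * D w z" by blast
  from degree_belowE[OF Suc.prems(2)] obtain E where E: "\<And>v. v \<in> half_spin \<Longrightarrow> degree_below d (E v)"
    "\<And>v z. v \<in> half_spin \<Longrightarrow> z \<in> half_spin \<Longrightarrow>
      ((\<lambda>t. Q (\<lambda>S. z S + t * v S)) has_field_derivative E v z) (at 0)"
    "\<And>v w z k. v \<in> half_spin \<Longrightarrow> w \<in> half_spin \<Longrightarrow> z \<in> half_spin \<Longrightarrow>
      E (\<lambda>S. v S + k * w S) z = E v z + k * E w z" by blast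
  show ?case
    by (rule degree_belowI[where D = "\<lambda>v z. D v z + E v z"])
      (use D E Suc.IH in \<open>auto intro: DERIV_add simp: distrib_left add_ac\<close>)
qed simp

text \<open>Leibniz rule: each term of the derivative lowers only one of the two bounds, hence the
  induction on \<open>d + d'\<close>. The bound is one above the sharp one, which is harmless since
  only its existence is used later.\<close>

lemma degree_below_mult: "degree_below d P \<Longrightarrow> degree_below d' Q \<Longrightarrow> degree_below (d + d') (\<lambda>z. P z * Q z)"
proof (induction "d + d'" arbitrary: d d' P Q rule: less_induct)
  case less
  show ?case
  proof (cases "d = 0 \<or> d' = 0")
    case True
    then show ?thesis using less.prems by (intro degree_below_cong[OF degree_below_zero]) auto
  next
    case False
    then obtain m n where mn: "d = Suc m" "d' = Suc n" by (metis not0_implies_Suc)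
    from degree_belowE[OF less.prems(1)[unfolded mn]] obtain D where
      D: "\<And>v. v \<in> half_spin \<Longrightarrow> degree_below m (D v)"
      "\<And>v z. v \<in> half_spin \<Longrightarrow> z \<in> half_spin \<Longrightarrow>
        ((\<lambda>t. P (\<lambda>S. z S + t * v S)) has_field_derivative D v z) (at 0)"
      "\<And>v w z k. v \<in> half_spin \<Longrightarrow> w \<in> half_spin \<Longrightarrow> z \<in> half_spin \<Longrightarrow>
        D (\<lambda>S. v S + k * w S) z = D v z + k * D w z" by blast
    from degree_belowE[OF less.prems(2)[unfolded mn]] obtain E where
      E: "\<And>v. v \<in> half_spin \<Longrightarrow> degree_below n (E v)"
      "\<And>v z. v \<in> half_spin \<Longrightarrow> z \<in> half_spin \<Longrightarrow>
        ((\<lambda>t. Q (\<lambda>S. z S + t * v S)) has_field_derivative E v z) (at 0)"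
      "\<And>v w z k. v \<in> half_spin \<Longrightarrow> w \<in> half_spin \<Longrightarrow> z \<in> half_spin \<Longrightarrow>
        E (\<lambda>S. v S + k * w S) z = E v z + k * E w z" by blast
    have "degree_below (Suc (m + d')) (\<lambda>z. P z * Q z)"
    proof (rule degree_belowI[where D = "\<lambda>v z. D v z * Q z + P z * E v z"])
      fix v assume v: "v \<in> half_spin"
      have "degree_below (m + d') (\<lambda>z. D v z * Q z)"
        using less.hyps[of m d'] mn D(1)[OF v] less.prems(2) by simp
      moreover have "degree_below (d + n) (\<lambda>z. P z * E v z)"
        using less.hyps[of d n] mn E(1)[OF v] less.prems(1) by simp
      ultimately show "degree_below (m + d') (\<lambda>z. D v z * Q z + P z * E v z)"
        by (intro degree_below_add) (simp_all add: mn)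
    next
      fix v z assume "v \<in> half_spin" "z \<in> half_spin"
      from DERIV_mult[OF D(2)[OF this] E(2)[OF this]]
      show "((\<lambda>t. P (\<lambda>S. z S + t * v S) * Q (\<lambda>S. z S + t * v S)) has_field_derivative
        D v z * Q z + P z * E v z) (at 0)" by (simp add: mult.commute)
    next
      fix v w z k assume *: "v \<in> half_spin" "w \<in> half_spin" "z \<in> half_spin"
      show "D (\<lambda>S. v S + k * w S) z * Q z + P z * E (\<lambda>S. v S + k * w S) z
        = D v z * Q z + P z * E v z + k * (D w z * Q z + P z * E w z)"
        unfolding D(3)[OF *] E(3)[OF *] by (simp only: algebra_simps)
    qed
    then show ?thesis by (simp add: mn)
  qed
qed

definition bounded_degree :: "((nat set \<Rightarrow> complex) \<Rightarrow> complex) \<Rightarrow> bool" where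
  "bounded_degree P \<longleftrightarrow> (\<exists>d. degree_below d P)"

lemma bounded_degree_const: "bounded_degree (\<lambda>z. k)"
  unfolding bounded_degree_def using degree_below_const by blast

lemma bounded_degree_coord: "bounded_degree (\<lambda>z. z S)"
  unfolding bounded_degree_def using degree_below_coord by blast

lemma bounded_degree_add: "bounded_degree P \<Longrightarrow> bounded_degree Q \<Longrightarrow> bounded_degree (\<lambda>z. P z + Q z)"
  unfolding bounded_degree_def using degree_below_add degree_below_mono by (meson nle_le)

lemma bounded_degree_mult: "bounded_degree P \<Longrightarrow> bounded_degree Q \<Longrightarrow> bounded_degree (\<lambda>z. P z * Q z)"
  unfolding bounded_degree_def using degree_below_mult by blast

lemma bounded_degree_power: "bounded_degree P \<Longrightarrow> bounded_degree (\<lambda>z. P z ^ n)"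
  by (induction n) (auto intro: bounded_degree_const bounded_degree_mult)

lemma bounded_degree_sum: "(\<And>i. i \<in> I \<Longrightarrow> bounded_degree (P i)) \<Longrightarrow> bounded_degree (\<lambda>z. \<Sum>i\<in>I. P i z)"
  by (induction I rule: infinite_finite_induct) (auto intro: bounded_degree_const bounded_degree_add)

lemma bounded_degree_prod: "(\<And>i. i \<in> I \<Longrightarrow> bounded_degree (P i)) \<Longrightarrow> bounded_degree (\<lambda>z. \<Prod>i\<in>I. P i z)"
  by (induction I rule: infinite_finite_induct) (auto intro: bounded_degree_const bounded_degree_mult)

lemma homogeneous_imp_bounded_degree:
  assumes "homogeneous_on_half_spin d P"
  shows "bounded_degree P"
proof -
  obtain A :: "(nat set \<Rightarrow> nat) set" and a where A: "finite A"
    "\<forall>z\<in>half_spin. P z = (\<Sum>\<alpha>\<in>A. a \<alpha> * (\<Prod>S\<in>spin_coords. z S ^ \<alpha> S))"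
    using assms(1) unfolding homogeneous_on_half_spin_def by metis
  have "bounded_degree (\<lambda>z. \<Sum>\<alpha>\<in>A. a \<alpha> * (\<Prod>S\<in>spin_coords. z S ^ \<alpha> S))"
    by (intro bounded_degree_sum bounded_degree_mult bounded_degree_const bounded_degree_prod bounded_degree_power bounded_degree_coord)
  then obtain d where d: "degree_below d (\<lambda>z. \<Sum>\<alpha>\<in>A. a \<alpha> * (\<Prod>S\<in>spin_coords. z S ^ \<alpha> S))"
    unfolding bounded_degree_def by blast
  have "degree_below d P" by (rule degree_below_cong[OF d]) (use A(2) in simp)
  then show ?thesis unfolding bounded_degree_def by blast
qed

text \<open>The value \<open>s = -1\<close> is excluded because the line \<open>z + s z\<close> inside a cone \<open>X\<close> passes through \<open>0\<close>.\<close>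

inductive_set line_span :: "(nat set \<Rightarrow> complex) set \<Rightarrow> (nat set \<Rightarrow> complex) \<Rightarrow> (nat set \<Rightarrow> complex) set"
  for X z where
  line: "d \<in> half_spin \<Longrightarrow> (\<And>s. s \<noteq> -1 \<Longrightarrow> (\<lambda>S. z S + s * d S) \<in> X) \<Longrightarrow> d \<in> line_span X z"
| comb: "v \<in> line_span X z \<Longrightarrow> w \<in> line_span X z \<Longrightarrow> (\<lambda>S. v S + k * w S) \<in> line_span X z"

lemma line_span_subset: "line_span X z \<subseteq> half_spin"
proof
  fix d assume "d \<in> line_span X z"
  then show "d \<in> half_spin" by induction (auto intro: half_spin_comb)
qed

text \<open>Restrict to the real axis; real and imaginary part then have zero derivative and are
  constant.\<close>

lemma DERIV_zero_complex_const:
  fixes g :: "complex \<Rightarrow> complex"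
  assumes "\<And>t. (g has_field_derivative 0) (at t)"
  shows "g 1 = g 0"
proof -
  have zero: "(*) (0 :: complex) = (\<lambda>_. 0)" "(*) (0 :: real) = (\<lambda>_. 0)" by auto
  have d: "((\<lambda>t. g (of_real t)) has_derivative (\<lambda>_. 0)) (at t)" for t :: real
  proof -
    have "(g has_derivative (\<lambda>_. 0)) (at (of_real t))"
      using assms[of "of_real t"] by (simp add: has_field_derivative_def zero)
    from has_derivative_compose[OF bounded_linear.has_derivative[OF bounded_linear_of_real has_derivative_ident] this]
    show ?thesis .
  qed
  have "((\<lambda>t. Re (g (of_real t))) has_field_derivative 0) (at t)"
    "((\<lambda>t. Im (g (of_real t))) has_field_derivative 0) (at t)" for t :: real
    using bounded_linear.has_derivative[OF bounded_linear_Re d[of t]]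
      bounded_linear.has_derivative[OF bounded_linear_Im d[of t]]
    by (simp_all add: has_field_derivative_def zero)
  then have "Re (g (of_real 1)) = Re (g (of_real 0))" "Im (g (of_real 1)) = Im (g (of_real 0))"
    using DERIV_isconst_all[of "\<lambda>t. Re (g (of_real t))" 1 0]
      DERIV_isconst_all[of "\<lambda>t. Im (g (of_real t))" 1 0] by auto
  then show ?thesis by (simp add: complex_eq_iff)
qed

text \<open>If the directions of the lines inside \<open>X\<close> span everything at each point of \<open>X\<close>, then all
  derivatives of a polynomial vanishing on \<open>X\<close> vanish on \<open>X\<close> again; induct on the degree.\<close>

lemma degree_below_vanishing:
  assumes "\<And>z. z \<in> X \<Longrightarrow> half_spin \<subseteq> line_span X z" "X \<subseteq> half_spin" "x \<in> X"
  shows "degree_below d P \<Longrightarrow> (\<And>z. z \<in> X \<Longrightarrow> P z = 0) \<Longrightarrow> z \<in> half_spin \<Longrightarrow> P z = 0"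
proof (induction d arbitrary: P z)
  case (Suc d)
  from degree_belowE[OF Suc.prems(1)] obtain D where D: "\<And>v. v \<in> half_spin \<Longrightarrow> degree_below d (D v)"
    "\<And>v z. v \<in> half_spin \<Longrightarrow> z \<in> half_spin \<Longrightarrow>
      ((\<lambda>t. P (\<lambda>S. z S + t * v S)) has_field_derivative D v z) (at 0)"
    "\<And>v w z k. v \<in> half_spin \<Longrightarrow> w \<in> half_spin \<Longrightarrow> z \<in> half_spin \<Longrightarrow>
      D (\<lambda>S. v S + k * w S) z = D v z + k * D w z" by blast
  have D0: "D v y = 0" if y: "y \<in> X" and "v \<in> line_span X y" for v y
    using that(2)
  proof induction
    case (line d)
    have "\<forall>\<^sub>F s in nhds 0. P (\<lambda>S. y S + s * d S) = 0"
    \<comment> \<open>The derivative at 0 only sees parameters near 0, and the excluded value -1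
      stays away from them.\<close>
    proof (rule eventually_nhds_in_open[of "- {-1 :: complex}", THEN eventually_mono])
      fix s :: complex assume "s \<in> - {-1}"
      then have "s \<noteq> -1" by simp
      then show "P (\<lambda>S. y S + s * d S) = 0" using line Suc.prems(2) by blast
    qed auto
    then have "((\<lambda>s. 0) has_field_derivative D d y) (at 0)"
      using D(2)[of d y] line y assms(2) DERIV_cong_ev[of 0 0 "\<lambda>s. P (\<lambda>S. y S + s * d S)" "\<lambda>s. 0"]
      by auto
    then show ?case using DERIV_unique DERIV_const by blast
  next
    \<comment> \<open>Linearity of the derivative in its direction, part of
      \<open>degree_below\<close>, carries vanishing from the lines to their span.\<close>
    case (comb v w k)
    then show ?case using D(3)[of v w y k] line_span_subset[of X y] y assms(2) by auto
  qed
  have Dz: "D v y = 0" if "v \<in> half_spin" "y \<in> half_spin" for v y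
    using Suc.IH[OF D(1)[OF that(1)]] D0 assms(1) that by blast
  \<comment> \<open>All directional derivatives now vanish on the whole space, so \<open>P\<close>
    is constant along the segment from \<open>x\<close> to \<open>z\<close>, and one point of
    \<open>X\<close> suffices.\<close>
  define v where "v = (\<lambda>S. z S - x S)"
  have x: "x \<in> half_spin" using assms by auto
  have v: "v \<in> half_spin" using x Suc.prems(3) by (simp add: v_def half_spin_def)
  have "((\<lambda>t. P (\<lambda>S. x S + t * v S)) has_field_derivative 0) (at t)" for t
  proof -
    have "((\<lambda>s. P (\<lambda>S. (x S + t * v S) + s * v S)) has_field_derivative 0) (at 0)"
      using D(2)[OF v half_spin_comb[OF x v, of t]] Dz[OF v half_spin_comb[OF x v, of t]] by simp
    moreover have "(\<lambda>s. P (\<lambda>S. (x S + t * v S) + s * v S)) = (\<lambda>s. P (\<lambda>S. x S + (s + t) * v S))"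
      by (simp add: algebra_simps)
    ultimately show ?thesis using DERIV_shift[of "\<lambda>t. P (\<lambda>S. x S + t * v S)" 0 0 t] by simp
  qed
  then have "P (\<lambda>S. x S + 1 * v S) = P (\<lambda>S. x S + 0 * v S)"
    by (rule DERIV_zero_complex_const)
  then have "P z = P x" by (simp add: v_def)
  then show ?case using Suc.prems(2) assms(3) by simp
qed simp

lemma bounded_degree_vanishing:
  assumes "\<And>z. z \<in> X \<Longrightarrow> half_spin \<subseteq> line_span X z" "X \<subseteq> half_spin" "X \<noteq> {}"
    and "bounded_degree P" "\<And>z. z \<in> X \<Longrightarrow> P z = 0" "z \<in> half_spin"
  shows "P z = 0"
proof -
  obtain d x where "degree_below d P" "x \<in> X" using assms(3,4) by (auto simp: bounded_degree_def)
  then show ?thesis using degree_below_vanishing[of X x d P z] assms(1,2,5,6) by blast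
qed

section \<open>Creation and annihilation operators\<close>

text \<open>The sign for moving the i-th basis vector past the smaller indices in \<open>S\<close>.
  It ignores whether \<open>i\<close> is in \<open>S\<close>, so the same sign serves creation and
  annihilation.\<close>

definition sg :: "nat \<Rightarrow> nat set \<Rightarrow> complex" where
  "sg i S = (-1) ^ card {j\<in>S. j < i}"

lemma sg_insert: "sg i (insert j S) = (if j < i \<and> j \<notin> S then - sg i S else sg i S)"
proof -
  have "{k\<in>insert j S. k < i} = (if j < i then insert j {k\<in>S. k < i} else {k\<in>S. k < i})" by auto
  moreover have "finite {k\<in>S. k < i}" by (rule finite_subset[of _ "{..<i}"]) auto
  ultimately show ?thesis by (auto simp: sg_def card_insert_if insert_absorb)
qed

lemma sg_remove: "sg i (S - {j}) = (if j < i \<and> j \<in> S then - sg i S else sg i S)"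
proof (cases "j \<in> S")
  case True
  then have "sg i S = sg i (insert j (S - {j}))" by (simp add: insert_absorb)
  then show ?thesis using True unfolding sg_insert by auto
qed simp

lemma sg_square: "sg i S * sg i S = 1"
  by (simp add: sg_def power_add[symmetric] mult_2[symmetric])

text \<open>Exterior multiplication by a basis vector; \<open>annihilate\<close> is the plain
  contraction, the factor 2 of the Clifford action being added in \<open>gen\<close>. Indices are
  unbounded, so \<open>create\<close> also serves for \<wedge>V.\<close>

definition create :: "nat \<Rightarrow> (nat set \<Rightarrow> complex) \<Rightarrow> nat set \<Rightarrow> complex" where
  "create i x S = (if i \<in> S then sg i S * x (S - {i}) else 0)"

definition annihilate :: "nat \<Rightarrow> (nat set \<Rightarrow> complex) \<Rightarrow> nat set \<Rightarrow> complex" where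
  "annihilate i x S = (if i \<in> S then 0 else sg i S * x (insert i S))"

text \<open>Together with \<open>annihilate_annihilate\<close> and \<open>create_annihilate\<close>
  these are the canonical anticommutation relations: adding or removing the smaller of two indices
  flips exactly one of the signs.\<close>

lemma create_create: "create i (create j x) S + create j (create i x) S = 0"
proof -
  have "S - {i} - {j} = S - {j} - {i}" by auto
  then show ?thesis by (auto simp: create_def sg_remove)
qed

lemma annihilate_annihilate: "annihilate i (annihilate j x) S + annihilate j (annihilate i x) S = 0"
  by (auto simp: annihilate_def sg_insert insert_commute)

lemma create_annihilate:
  "create i (annihilate j x) S + annihilate j (create i x) S = (if i = j then x S else 0)"
proof (cases "i = j")
  case True
  then show ?thesis
    by (auto simp: create_def annihilate_def sg_insert sg_remove insert_absorb sg_square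
        mult.assoc[symmetric])
next
  case False
  then have "insert j S - {i} = insert j (S - {i})" by auto
  then show ?thesis using False by (auto simp: create_def annihilate_def sg_insert sg_remove)
qed

text \<open>The Clifford action of \<open>basis_vec k\<close>. The factor 2 makes the anticommutator
  of a dual pair equal to 2, in accordance with v v = q(v).\<close>

definition gen :: "nat \<Rightarrow> (nat set \<Rightarrow> complex) \<Rightarrow> nat set \<Rightarrow> complex" where
  "gen k x S = (if k < 7 then create k x S else 2 * annihilate (k - 7) x S)"

definition dual_index :: "nat \<Rightarrow> nat" where
  "dual_index k = (if k < 7 then k + 7 else k - 7)"

lemma dual_index_less [simp]: "k < 14 \<Longrightarrow> dual_index k < 14"
  by (auto simp: dual_index_def)

lemma dual_index_dual_index [simp]: "k < 14 \<Longrightarrow> dual_index (dual_index k) = k"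
  by (auto simp: dual_index_def)

lemma create_scale: "create k (\<lambda>S. c * x S) S = c * create k x S"
  by (simp add: create_def)

lemma annihilate_scale: "annihilate k (\<lambda>S. c * x S) S = c * annihilate k x S"
  by (simp add: annihilate_def)

lemma gen_create: "k < 7 \<Longrightarrow> gen k = create k"
  by (intro ext) (simp add: gen_def)

lemma gen_annihilate: "\<not> k < 7 \<Longrightarrow> gen k = (\<lambda>x S. 2 * annihilate (k - 7) x S)"
  by (intro ext) (simp add: gen_def)

lemma gen_gen:
  assumes "k < 14" "l < 14"
  shows "gen k (gen l x) S + gen l (gen k x) S = (if l = dual_index k then 2 * x S else 0)"
proof -
  consider "k < 7" "l < 7" | "k < 7" "\<not> l < 7" | "\<not> k < 7" "l < 7" | "\<not> k < 7" "\<not> l < 7" by blast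
  then show ?thesis
  proof cases
    case 1
    then show ?thesis by (simp add: gen_create create_create dual_index_def)
  next
    case 2
    then show ?thesis using create_annihilate[of k "l - 7" x S]
      by (auto simp: gen_create gen_annihilate create_scale dual_index_def
          distrib_left[symmetric])
  next
    case 3
    then show ?thesis using create_annihilate[of l "k - 7" x S]
      by (auto simp: gen_create gen_annihilate create_scale dual_index_def
          distrib_left[symmetric] add.commute)
  next
    case 4
    then show ?thesis using annihilate_annihilate[of "k - 7" "l - 7" x S] assms
      by (simp add: gen_annihilate annihilate_scale dual_index_def distrib_left[symmetric])
  qed
qed

text \<open>All of \<wedge>E, even and odd: intermediate Clifford products leave
  \<open>half_spin\<close>. The support condition discards the irrelevant arguments, infinite sets
  among them.\<close>

definition spinors :: "(nat set \<Rightarrow> complex) set" where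
  "spinors = {x. \<forall>S. \<not> S \<subseteq> {..<7} \<longrightarrow> x S = 0}"

lemma half_spin_subset_spinors: "half_spin \<subseteq> spinors"
  by (auto simp: half_spin_def spinors_def spin_coords_def)

lemma gen_spinors: "x \<in> spinors \<Longrightarrow> k < 14 \<Longrightarrow> gen k x \<in> spinors"
proof -
  assume x: "x \<in> spinors" and k: "k < 14"
  have "gen k x S = 0" if "\<not> S \<subseteq> {..<7}" for S
  proof -
    have "\<not> insert j S \<subseteq> {..<7}" for j using that by auto
    moreover have "\<not> S - {k} \<subseteq> {..<7}" if "k < 7" using that \<open>\<not> S \<subseteq> {..<7}\<close> by auto
    ultimately show ?thesis using x
      by (simp add: spinors_def gen_def create_def annihilate_def)
  qed
  then show ?thesis by (simp add: spinors_def)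
qed

lemma gen_sum: "gen k (\<lambda>S. \<Sum>i\<in>I. c i * x i S) S = (\<Sum>i\<in>I. c i * gen k (x i) S)"
  by (simp add: gen_def create_def annihilate_def sum_distrib_left mult_ac)

lemma gen_add: "gen k (\<lambda>S. x S + c * y S) S = gen k x S + c * gen k y S"
  by (simp add: gen_def create_def annihilate_def algebra_simps)

lemma ext_vec_singleton: "i < n \<Longrightarrow> ext_vec n c {i} = c i"
  by (simp add: ext_vec_def)

lemma ext_vec_eq_0: "(\<And>i. i < n \<Longrightarrow> S \<noteq> {i}) \<Longrightarrow> ext_vec n c S = 0"
  by (simp add: ext_vec_def)

text \<open>A vector has coordinates only on singletons, and the inversions of \<open>{i}\<close>
  against \<open>S - {i}\<close> are what \<open>sg i S\<close> counts.\<close>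

lemma wedge_ext_vec:
  assumes "finite S"
  shows "wedge (ext_vec n c) y S = (\<Sum>i\<in>S \<inter> {..<n}. sg i S * c i * y (S - {i}))"
proof -
  let ?g = "\<lambda>A. (-1) ^ card {(a, b). a \<in> A \<and> b \<in> S - A \<and> b < a} * ext_vec n c A * y (S - A)"
  have "wedge (ext_vec n c) y S = sum ?g ((\<lambda>i. {i}) ` (S \<inter> {..<n}))"
    unfolding wedge_def
    by (rule sum.mono_neutral_right) (use assms in \<open>auto intro: ext_vec_eq_0\<close>)
  also have "\<dots> = (\<Sum>i\<in>S \<inter> {..<n}. ?g {i})"
    by (subst sum.reindex) (auto simp: inj_on_def)
  also have "\<dots> = (\<Sum>i\<in>S \<inter> {..<n}. sg i S * c i * y (S - {i}))"
  proof (rule sum.cong)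
    fix i assume i: "i \<in> S \<inter> {..<n}"
    have "{(a, b). a \<in> {i} \<and> b \<in> S - {i} \<and> b < a} = Pair i ` {j\<in>S. j < i}" by auto
    then have "card {(a, b). a \<in> {i} \<and> b \<in> S - {i} \<and> b < a} = card {j\<in>S. j < i}"
      by (simp add: card_image inj_on_def)
    then show "?g {i} = sg i S * c i * y (S - {i})" using i by (simp add: sg_def ext_vec_singleton)
  qed simp
  finally show ?thesis .
qed

lemma sum_lessThan_14: "(\<Sum>k<14. h k) = (\<Sum>k<7. h k) + (\<Sum>k<7. h (k + 7 :: nat))"
  by (simp add: lessThan_nat_numeral lessThan_Suc eval_nat_numeral add_ac)

lemma sum_dual_index: "(\<Sum>k<14. h (dual_index k)) = (\<Sum>k<14. h k)"
  by (rule sum.reindex_bij_witness[of _ dual_index dual_index]) auto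

section \<open>The invariant pairing\<close>

text \<open>The shuffle sign of \<open>A\<close> against its complement times the reversal sign; by
  \<open>pair_sign_eq\<close> it depends only on the parity of the sum of \<open>A\<close>.\<close>

definition pair_sign :: "nat set \<Rightarrow> complex" where
  "pair_sign A = (-1) ^ card {(a, b). a \<in> A \<and> b \<in> {..<7} - A \<and> b < a}
     * (-1) ^ (card A * (card A - 1) div 2)"

lemma spin_pairing_eq:
  "spin_pairing x y = (\<Sum>A\<in>Pow {..<7}. pair_sign A * x A * y ({..<7} - A))"
  by (simp add: spin_pairing_def wedge_def reversal_def pair_sign_def mult_ac)

lemma finite_inversions: "finite A \<Longrightarrow> finite {(a, b). a \<in> A \<and> b \<in> {..<7::nat} - A \<and> b < a}"
  by (rule finite_subset[of _ "A \<times> {..<7}"]) auto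

lemma triangle_Suc: "Suc n * (Suc n - 1) div 2 = n * (n - 1) div 2 + n"
proof (cases n)
  case (Suc m)
  have "Suc n * (Suc n - 1) = n * (n - 1) + n * 2" by (simp add: Suc algebra_simps)
  then show ?thesis by simp
qed simp

text \<open>Inserting \<open>i\<close> gains the inversions with smaller indices of the complement,
  loses those of larger elements of \<open>A\<close> with \<open>i\<close>, and raises the
  triangular exponent by \<open>card A\<close>. Modulo 2 only the elements below \<open>i\<close>,
  in \<open>A\<close> and in the complement, remain.\<close>

lemma pair_sign_insert:
  assumes "A \<subseteq> {..<7}" "i < 7" "i \<notin> A"
  shows "pair_sign (insert i A) * sg i A = pair_sign A * sg i ({..<7} - A)"
proof -
  have fin: "finite A" using assms finite_subset by blast
  let ?I = "\<lambda>A. {(a, b). a \<in> A \<and> b \<in> {..<7::nat} - A \<and> b < a}"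
  let ?lo = "{j\<in>A. j < i}" and ?hi = "{j\<in>A. i < j}" and ?co = "{j\<in>{..<7} - A. j < i}"
  have 1: "card (?I (insert i A)) + card ?hi = card (?I A) + card ?co"
  proof -
    let ?C = "?I (insert i A) \<inter> ?I A"
    have "?I (insert i A) = ?C \<union> Pair i ` ?co" using assms by auto
    moreover have "?I A = ?C \<union> (\<lambda>a. (a, i)) ` ?hi" using assms by auto
    moreover have "?C \<inter> Pair i ` ?co = {}" "?C \<inter> (\<lambda>a. (a, i)) ` ?hi = {}" using assms by auto
    moreover have "finite ?C" "finite ?co" "finite ?hi"
      using finite_inversions[OF fin] fin by auto
    ultimately have "card (?I (insert i A)) = card ?C + card ?co" "card (?I A) = card ?C + card ?hi"
      by (metis (no_types, lifting) card_Un_disjoint card_image finite_imageI inj_on_def prod.inject)+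
    then show ?thesis by simp
  qed
  have 2: "card A = card ?lo + card ?hi"
  proof -
    have "A = ?lo \<union> ?hi" using assms(3) nat_neq_iff by auto
    moreover have "?lo \<inter> ?hi = {}" by auto
    ultimately show ?thesis using fin by (metis (no_types, lifting) card_Un_disjoint finite_Un)
  qed
  have 3: "even (card (?I (insert i A)) + card A + card ?lo + (card (?I A) + card ?co))"
  proof -
    have "a + h = c + d \<Longrightarrow> n = l + h \<Longrightarrow> even (a + n + l + (c + d))" for a c d h l n :: nat
      by presburger
    then show ?thesis using 1 2 .
  qed
  have "card (insert i A) * (card (insert i A) - 1) div 2 = card A * (card A - 1) div 2 + card A"
    using assms(3) fin by (simp add: triangle_Suc[simplified])
  moreover have "(-1::complex) ^ (card (?I (insert i A)) + card A + card ?lo)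
      = (-1) ^ (card (?I A) + card ?co)"
    using 3 by (simp add: minus_one_power_iff)
  ultimately show ?thesis
    by (simp add: pair_sign_def sg_def power_add mult_ac)
qed

text \<open>Sets are grouped as \<open>A\<close> and \<open>insert i A\<close>, since creation and
  annihilation at \<open>i\<close> exchange the two; adjointness is then checked pair by
  pair.\<close>

lemma sum_Pow_split:
  assumes "i < (7::nat)"
  shows "(\<Sum>A\<in>Pow {..<7}. h A) = (\<Sum>A\<in>Pow ({..<7} - {i}). h A + h (insert i A))"
proof -
  have "Pow {..<7} = Pow ({..<7} - {i}) \<union> insert i ` Pow ({..<7} - {i})"
    using assms Pow_insert[of i "{..<7} - {i}"] by (simp add: insert_absorb)
  moreover have "Pow ({..<7} - {i}) \<inter> insert i ` Pow ({..<7} - {i}) = {}" by auto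
  moreover have "inj_on (insert i) (Pow ({..<7} - {i}))" by (auto simp: inj_on_def)
  ultimately show ?thesis by (simp add: sum.union_disjoint sum.reindex sum.distrib)
qed

text \<open>Reversal fixes vectors and reverses products, so \<tau>(e \<wedge> x) \<wedge> y =
  \<tau>(x) \<wedge> e \<wedge> y.\<close>

lemma pairing_create:
  assumes "i < 7"
  shows "spin_pairing (create i x) y = spin_pairing x (create i y)"
  unfolding spin_pairing_eq sum_Pow_split[OF assms]
proof (rule sum.cong)
  fix A assume A: "A \<in> Pow ({..<7} - {i})"
  then have "{..<7} - A - {i} = {..<7} - insert i A" "insert i A - {i} = A" by auto
  then show "pair_sign A * create i x A * y ({..<7} - A)
      + pair_sign (insert i A) * create i x (insert i A) * y ({..<7} - insert i A)
    = pair_sign A * x A * create i y ({..<7} - A)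
      + pair_sign (insert i A) * x (insert i A) * create i y ({..<7} - insert i A)"
    using A assms pair_sign_insert[of A i] by (auto simp: create_def sg_insert)
qed simp

lemma pairing_annihilate:
  assumes "i < 7"
  shows "spin_pairing (annihilate i x) y = spin_pairing x (annihilate i y)"
  unfolding spin_pairing_eq sum_Pow_split[OF assms]
proof (rule sum.cong)
  fix A assume A: "A \<in> Pow ({..<7} - {i})"
  then have e: "insert i ({..<7} - insert i A) = {..<7} - A" using assms by auto
  have "sg i ({..<7} - insert i A) = sg i ({..<7} - A)"
    using sg_remove[of i "{..<7} - A" i] Diff_insert2[of "{..<7}" i A] Diff_insert[of "{..<7}" i A]
    by simp
  then have "pair_sign A * sg i A = pair_sign (insert i A) * sg i ({..<7} - insert i A)"
    using pair_sign_insert[of A i] A assms sg_square[of i A] sg_square[of i "{..<7} - A"]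
    by (smt (verit) Diff_empty Diff_insert2 Pow_iff insert_Diff_if lessThan_iff mult.assoc
        mult.commute mult.right_neutral subset_Diff_insert)
  then show "pair_sign A * annihilate i x A * y ({..<7} - A)
      + pair_sign (insert i A) * annihilate i x (insert i A) * y ({..<7} - insert i A)
    = pair_sign A * x A * annihilate i y ({..<7} - A)
      + pair_sign (insert i A) * x (insert i A) * annihilate i y ({..<7} - insert i A)"
    using A assms e by (auto simp: annihilate_def)
qed simp

lemma pairing_gen: "k < 14 \<Longrightarrow> spin_pairing (gen k x) y = spin_pairing x (gen k y)"
proof (cases "k < 7")
  case False
  assume "k < 14"
  with False have "spin_pairing (annihilate (k - 7) x) y = spin_pairing x (annihilate (k - 7) y)"
    by (intro pairing_annihilate) auto
  then show ?thesis using False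
    by (simp add: gen_annihilate spin_pairing_eq sum_distrib_left[symmetric] mult.left_commute[of _ 2]
        mult.assoc)
qed (simp add: gen_create pairing_create)

lemma sg_compl:
  assumes "i < 7"
  shows "sg i ({..<7} - A) = (-1) ^ i * sg i A"
proof -
  have "{j\<in>{..<7} - A. j < i} = {..<i} - {j\<in>A. j < i}" using assms by auto
  then have "card {j\<in>{..<7} - A. j < i} = i - card {j\<in>A. j < i}"
    by (simp add: card_Diff_subset subset_eq finite_subset[of _ "{..<i}"])
  moreover have "card {j\<in>A. j < i} \<le> i"
    using card_mono[of "{..<i}" "{j\<in>A. j < i}"] by auto
  ultimately show ?thesis by (simp add: sg_def minus_one_power_iff)
qed

text \<open>By \<open>pair_sign_insert\<close> a new element \<open>i\<close> contributes the signs
  of the indices below \<open>i\<close> in \<open>A\<close> and in its complement; together these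
  are \<open>i\<close> indices.\<close>

lemma pair_sign_eq:
  assumes "A \<subseteq> {..<7}"
  shows "pair_sign A = (-1) ^ (\<Sum>A)"
proof -
  have "finite A" using assms finite_subset by blast
  then show ?thesis using assms
  proof (induction A)
    case (insert i A)
    then have "pair_sign (insert i A) * sg i A = pair_sign A * (-1) ^ i * sg i A"
      using pair_sign_insert[of A i] sg_compl[of i A] by simp
    moreover have "sg i A \<noteq> 0" by (simp add: sg_def)
    ultimately have "pair_sign (insert i A) = pair_sign A * (-1) ^ i" by simp
    then show ?case using insert by (simp add: power_add)
  qed (simp add: pair_sign_def)
qed

text \<open>The indices 0, ..., 6 add up to 21, which is odd; this is why the pairing on all of
  \<wedge>E is skew.\<close>

lemma pair_sign_compl:
  assumes "A \<subseteq> {..<7}"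
  shows "pair_sign ({..<7} - A) = - pair_sign A"
proof -
  have "\<Sum>A + \<Sum>({..<7} - A) = 21"
    using sum.subset_diff[OF assms, of "\<lambda>i. i"] by (simp add: lessThan_nat_numeral lessThan_Suc eval_nat_numeral)
  then have "even (\<Sum>({..<7} - A)) \<longleftrightarrow> odd (\<Sum>A)" by presburger
  then show ?thesis using assms by (simp add: pair_sign_eq minus_one_power_iff)
qed

lemma pairing_antisym: "spin_pairing y x = - spin_pairing x y"
proof -
  have "spin_pairing y x = (\<Sum>A\<in>Pow {..<7}. pair_sign ({..<7} - A) * y ({..<7} - A) * x A)"
    unfolding spin_pairing_eq
    by (rule sum.reindex_bij_witness[of _ "\<lambda>A. {..<7} - A" "\<lambda>A. {..<7} - A"])
      (auto simp: double_diff)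
  then show ?thesis
    by (simp add: spin_pairing_eq pair_sign_compl sum_negf[symmetric] mult_ac)
qed

lemma pairing_add_right: "spin_pairing x (\<lambda>S. y S + c * z S) = spin_pairing x y + c * spin_pairing x z"
  by (simp add: spin_pairing_eq sum_distrib_left sum.distrib algebra_simps)

lemma pairing_sum_right:
  "spin_pairing x (\<lambda>S. \<Sum>i\<in>I. c i * y i S) = (\<Sum>i\<in>I. c i * spin_pairing x (y i))"
  unfolding spin_pairing_eq sum_distrib_left by (subst sum.swap) (simp add: mult_ac)

lemma pairing_scale_right: "spin_pairing x (\<lambda>S. c * y S) = c * spin_pairing x y"
  by (simp add: spin_pairing_eq sum_distrib_left mult_ac)

section \<open>Linear forms and reflections\<close>

lemma sum_strict_pairs:
  fixes g :: "nat \<Rightarrow> nat \<Rightarrow> complex"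
  assumes "\<And>i j. g i j = g j i" "\<And>i. g i i = 0"
  shows "(\<Sum>j<n. \<Sum>i<j. g i j) = 1/2 * (\<Sum>i<n. \<Sum>j<n. g i j)"
proof (induction n)
  case (Suc n)
  have "(\<Sum>j<n. g n j) = (\<Sum>j<n. g j n)" using assms(1) by metis
  then show ?case using Suc assms(2) by (simp add: sum.distrib)
qed simp

text \<open>The range i < j < k is not stable under \<open>dual_index\<close>, whereas the full
  range is; all contractions are therefore moved to full sums.\<close>

lemma sum_strict_triples:
  fixes f :: "nat \<Rightarrow> nat \<Rightarrow> nat \<Rightarrow> complex"
  assumes swap12: "\<And>i j k. f i j k = f j i k" and swap23: "\<And>i j k. f i j k = f i k j"
    and diag: "\<And>i k. f i i k = 0"
  shows "(\<Sum>k<n. \<Sum>j<k. \<Sum>i<j. f i j k) = 1/6 * (\<Sum>i<n. \<Sum>j<n. \<Sum>k<n. f i j k)"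
proof (induction n)
  case (Suc n)
  have 0: "f i n n = 0" "f n i n = 0" for i using diag swap12 swap23 by metis+
  have 1: "f n i j = f i j n" "f i n j = f i j n" for i j using swap12 swap23 by metis+
  show ?case
    by (simp add: sum.distrib 0 Suc sum_strict_pairs[of "\<lambda>i j. f i j n", OF swap12 diag])
      (simp add: 1 diag)
qed simp

context split_quadratic_space_14
begin

lemma q_add_right: "q v (u + u') = q v u + q v u'"
  by (simp add: q_add q_sym[of v])

lemma q_scale_right: "q v (c *s u) = c * q v u"
  by (simp add: q_scale q_sym[of v])

lemma q_zero_left: "q 0 v = 0"
  using q_scale[of 0 0 v] by simp

lemma q_sum_left: "q (\<Sum>i\<in>I. u i) v = (\<Sum>i\<in>I. q (u i) v)"
  by (induction I rule: infinite_finite_induct) (auto simp: q_zero_left q_add)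

lemma q_diff_left: "q (u - u') v = q u v - q u' v"
  using q_add[of "u - u'" u' v] by simp

lemma dual_vec_eq: "k < 14 \<Longrightarrow> dual_vec k = basis_vec (dual_index k)"
  by (auto simp: dual_vec_def basis_vec_def dual_index_def)

lemma basis_vec_eq: "k < 14 \<Longrightarrow> basis_vec k = dual_vec (dual_index k)"
  by (simp add: dual_vec_eq)

lemma q_basis:
  assumes "k < 14" "l < 14"
  shows "q (basis_vec k) (basis_vec l) = (if l = dual_index k then 1 else 0)"
proof -
  have fe: "i < 7 \<Longrightarrow> j < 7 \<Longrightarrow> q (f i) (e j) = (if i = j then 1 else 0)" for i j
    using e_f_dual[of j i] q_sym[of "f i" "e j"] by auto
  show ?thesis using assms
    by (auto simp: basis_vec_def dual_index_def e_isotropic f_isotropic e_f_dual fe)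
qed

lemma dual_index_eq_iff: "k < 14 \<Longrightarrow> l < 14 \<Longrightarrow> dual_index k = dual_index l \<longleftrightarrow> k = l"
  by (auto simp: dual_index_def split: if_splits)

lemma q_basis_dual: "k < 14 \<Longrightarrow> l < 14 \<Longrightarrow> q (basis_vec k) (dual_vec l) = (if k = l then 1 else 0)"
  by (auto simp: dual_vec_eq q_basis dual_index_eq_iff)

lemma inj_basis_vec: "inj_on basis_vec {..<14}"
proof (rule inj_onI)
  fix k l assume "k \<in> {..<14}" "l \<in> {..<14}" "basis_vec k = basis_vec l"
  then show "k = l" using q_basis_dual[of k l] q_basis_dual[of l l] by (auto split: if_splits)
qed

lemma independent_basis_vec: "independent (basis_vec ` {..<14})"
proof (rule independent_if_scalars_zero)
  fix h v assume h: "(\<Sum>x\<in>basis_vec ` {..<14}. h x *s x) = 0" and v: "v \<in> basis_vec ` {..<14}"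
  obtain l where l: "l < 14" "v = basis_vec l" using v by auto
  have "q (\<Sum>k<14. h (basis_vec k) *s basis_vec k) (dual_vec l) = 0"
    using h by (simp add: sum.reindex[OF inj_basis_vec] q_zero_left)
  also have "q (\<Sum>k<14. h (basis_vec k) *s basis_vec k) (dual_vec l)
      = (\<Sum>k<14. if k = l then h (basis_vec k) else 0)"
    unfolding q_sum_left by (rule sum.cong) (use l in \<open>auto simp: q_scale q_basis_dual\<close>)
  finally show "h v = 0" using l by simp
qed simp

lemma span_basis_vec: "span (basis_vec ` {..<14}) = UNIV"
proof -
  obtain B where B: "independent B" "UNIV \<subseteq> span B" "card B = dim UNIV"
    using basis_exists[of UNIV] by metis
  then have "finite B" using dim_14 by (metis card.infinite zero_neq_numeral)
  with B interpret fd: finite_dimensional_vector_space scale B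
    by unfold_locales auto
  have "card (basis_vec ` {..<14}) = 14" by (simp add: card_image[OF inj_basis_vec])
  then have "UNIV \<subseteq> span (basis_vec ` {..<14})"
    using independent_basis_vec dim_14 by (intro fd.card_ge_dim_independent) auto
  then show ?thesis by auto
qed

text \<open>The difference of the two sides is orthogonal to every basis vector, hence to their
  span, which is everything.\<close>

lemma basis_expansion: "(\<Sum>k<14. q u (dual_vec k) *s basis_vec k) = u"
proof -
  define w where "w = u - (\<Sum>k<14. q u (dual_vec k) *s basis_vec k)"
  have b: "q w (basis_vec l) = 0" if "l < 14" for l
  proof -
    have "q (\<Sum>k<14. q u (dual_vec k) *s basis_vec k) (basis_vec l)
        = (\<Sum>k<14. if k = dual_index l then q u (dual_vec k) else 0)"
      unfolding q_sum_left
    proof (rule sum.cong)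
      fix k assume "k \<in> {..<14::nat}"
      then show "q (q u (dual_vec k) *s basis_vec k) (basis_vec l)
        = (if k = dual_index l then q u (dual_vec k) else 0)"
        using that by (auto simp: q_scale q_basis)
    qed simp
    also have "\<dots> = q u (basis_vec l)" using that by (simp add: basis_vec_eq)
    finally show ?thesis by (simp add: w_def q_diff_left)
  qed
  have "q w v = 0" for v
  proof -
    have "v \<in> span (basis_vec ` {..<14})" by (simp add: span_basis_vec)
    then show ?thesis
      by (induction rule: span_induct_alt)
        (use b q_zero_left q_sym[of w 0] in \<open>auto simp: q_add_right q_scale_right\<close>)
  qed
  then have "w = 0" by (rule q_nondegenerate)
  then show ?thesis by (simp add: w_def)
qed

definition linear_form :: "('v \<Rightarrow> complex) \<Rightarrow> bool" where
  "linear_form \<phi> \<longleftrightarrow> (\<forall>u v c. \<phi> (u + c *s v) = \<phi> u + c * \<phi> v)"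

lemma linear_formI: "(\<And>u v c. \<phi> (u + c *s v) = \<phi> u + c * \<phi> v) \<Longrightarrow> linear_form \<phi>"
  by (simp add: linear_form_def)

lemma linear_form_comb: "linear_form \<phi> \<Longrightarrow> \<phi> (u + c *s v) = \<phi> u + c * \<phi> v"
  by (simp add: linear_form_def)

lemma linear_form_zero: "linear_form \<phi> \<Longrightarrow> \<phi> 0 = 0"
  using linear_form_comb[of \<phi> 0 1 0] by simp

lemma linear_form_sum:
  assumes "linear_form \<phi>"
  shows "\<phi> (\<Sum>i\<in>I. c i *s u i) = (\<Sum>i\<in>I. c i * \<phi> (u i))"
  by (induction I rule: infinite_finite_induct)
    (auto simp: linear_form_zero[OF assms] linear_form_comb[OF assms]
      add.commute[of "_ *s _" "sum _ _"])

lemma linear_form_expand: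
  assumes "linear_form \<phi>"
  shows "(\<Sum>k<14. q u (dual_vec k) * \<phi> (basis_vec k)) = \<phi> u"
    and "(\<Sum>k<14. q u (basis_vec k) * \<phi> (dual_vec k)) = \<phi> u"
proof -
  show 1: "(\<Sum>k<14. q u (dual_vec k) * \<phi> (basis_vec k)) = \<phi> u"
    using linear_form_sum[OF assms, of "\<lambda>k. q u (dual_vec k)" basis_vec "{..<14}"]
    by (simp add: basis_expansion)
  have "(\<Sum>k<14. q u (basis_vec k) * \<phi> (dual_vec k))
    = (\<Sum>k<14. q u (dual_vec (dual_index k)) * \<phi> (basis_vec (dual_index k)))"
    by (rule sum.cong) (simp_all add: dual_vec_eq)
  then show "(\<Sum>k<14. q u (basis_vec k) * \<phi> (dual_vec k)) = \<phi> u"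
    using sum_dual_index[of "\<lambda>k. q u (dual_vec k) * \<phi> (basis_vec k)"] 1 by simp
qed

lemma linear_form_q: "linear_form (q u)"
  by (rule linear_formI) (simp add: q_add_right q_scale_right)

text \<open>For a unit vector this is minus the usual hyperplane reflection: it fixes
  \<open>r\<close> and negates the orthogonal complement. The sign is that of r a r = 2 q(r, a) r -
  a in the Clifford algebra.\<close>

definition reflection :: "'v \<Rightarrow> 'v \<Rightarrow> 'v" where
  "reflection r a = (2 * q r a) *s r + (-1) *s a"

lemma linear_form_reflection:
  assumes "linear_form \<phi>"
  shows "\<phi> (reflection r a) = 2 * q r a * \<phi> r - \<phi> a"
  unfolding reflection_def linear_form_comb[OF assms]
  using linear_form_comb[OF assms, of 0 "2 * q r a" r] linear_form_zero[OF assms] by simp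

lemma q_reflection:
  assumes "q r r = 1"
  shows "q (reflection r a) (reflection r b) = q a b"
proof -
  have "q (reflection r b) (reflection r a) = 2 * q r a * q (reflection r b) r - q (reflection r b) a"
    by (rule linear_form_reflection[OF linear_form_q])
  also have "\<dots> = q a b"
    using linear_form_reflection[OF linear_form_q, of r r b] linear_form_reflection[OF linear_form_q, of a r b]
      assms q_sym by (simp add: algebra_simps)
  finally show ?thesis using q_sym by simp
qed

lemma reflection_reflection:
  assumes "q r r = 1"
  shows "reflection r (reflection r a) = a"
proof -
  have "q r (reflection r a) = q r a"
    using linear_form_reflection[OF linear_form_q, of r r a] assms by simp
  then show ?thesis by (simp add: reflection_def scale_right_distrib scale_minus_left)
qed

text \<open>Contraction with the inverse of \<open>q\<close> is invariant under isometries. In the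
  expansion the correction terms are 4, -2 and -2 times \<open>\<phi> r r\<close> and
  cancel.\<close>

lemma dual_basis_reflection:
  assumes "\<And>v. linear_form (\<lambda>u. \<phi> u v)" "\<And>u. linear_form (\<phi> u)" "q r r = 1"
  shows "(\<Sum>k<14. \<phi> (reflection r (basis_vec k)) (reflection r (dual_vec k))) = (\<Sum>k<14. \<phi> (basis_vec k) (dual_vec k))"
proof -
  have "\<phi> (reflection r b) (reflection r d) = 4 * \<phi> r r * (q r b * q r d) - 2 * (q r b * \<phi> r d)
      - 2 * (q r d * \<phi> b r) + \<phi> b d" for b d
    by (simp only: linear_form_reflection[OF assms(1)] linear_form_reflection[OF assms(2)])
      (simp add: algebra_simps)
  then have "(\<Sum>k<14. \<phi> (reflection r (basis_vec k)) (reflection r (dual_vec k)))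
    = 4 * \<phi> r r * (\<Sum>k<14. q r (basis_vec k) * q r (dual_vec k))
      - 2 * (\<Sum>k<14. q r (basis_vec k) * \<phi> r (dual_vec k))
      - 2 * (\<Sum>k<14. q r (dual_vec k) * \<phi> (basis_vec k) r)
      + (\<Sum>k<14. \<phi> (basis_vec k) (dual_vec k))"
    by (simp add: sum.distrib sum_subtractf sum_distrib_left)
  also have "\<dots> = (\<Sum>k<14. \<phi> (basis_vec k) (dual_vec k))"
    using linear_form_expand(2)[OF linear_form_q, of r r] linear_form_expand(2)[OF assms(2), of r r]
      linear_form_expand(1)[OF assms(1), of r r] assms(3) by simp
  finally show ?thesis .
qed

section \<open>Clifford multiplication\<close>

text \<open>Reduces every Clifford computation to generators. Off the subsets of
  \<open>{..<7}\<close> both sides vanish; infinite sets are a separate case because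
  \<open>wedge\<close> sums over \<open>Pow S\<close>.\<close>

lemma clifford_eq:
  assumes "x \<in> spinors"
  shows "clifford u x = (\<lambda>S. \<Sum>k<14. q u (dual_vec k) * gen k x S)"
proof
  fix S
  have split: "(\<Sum>k<14. q u (dual_vec k) * gen k x S)
      = (\<Sum>i<7. q u (f i) * create i x S) + 2 * (\<Sum>i<7. q u (e i) * annihilate i x S)"
    unfolding sum_lessThan_14 sum_distrib_left
    by (intro arg_cong2[of _ _ _ _ "(+)"] sum.cong) (auto simp: dual_vec_def gen_def)
  show "clifford u x S = (\<Sum>k<14. q u (dual_vec k) * gen k x S)"
  proof (cases "S \<subseteq> {..<7}")
    case True
    then have "finite S" by (rule finite_subset) simp
    then have "wedge (ext_vec 7 (\<lambda>i. q u (f i))) x S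
        = (\<Sum>i\<in>S \<inter> {..<7}. sg i S * q u (f i) * x (S - {i}))"
      by (rule wedge_ext_vec)
    also have "\<dots> = (\<Sum>i<7. q u (f i) * create i x S)"
      by (rule sum.mono_neutral_cong_left) (use True in \<open>auto simp: create_def\<close>)
    moreover have "contraction u x S = (\<Sum>i<7. q u (e i) * annihilate i x S)"
      unfolding contraction_def
      by (rule sum.mono_neutral_cong_left) (auto simp: annihilate_def sg_def)
    ultimately show ?thesis by (simp add: split clifford_def)
  next
    case False
    have "wedge (ext_vec 7 (\<lambda>i. q u (f i))) x S = 0"
    proof (cases "finite S")
      case True
      have "x (S - {i}) = 0" if "i < 7" for i
      proof -
        have "\<not> S - {i} \<subseteq> {..<7}" using False that by auto
        then show ?thesis using assms by (auto simp: spinors_def)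
      qed
      then show ?thesis by (simp add: wedge_ext_vec[OF True])
    qed (simp add: wedge_def)
    moreover have "x (insert i S) = 0" for i
      using assms False by (auto simp: spinors_def)
    moreover have "gen k x S = 0" if "k < 14" for k
      using gen_spinors[OF assms that] False by (auto simp: spinors_def)
    ultimately show ?thesis by (simp add: clifford_def contraction_def)
  qed
qed

lemma clifford_spinors:
  assumes "x \<in> spinors"
  shows "clifford u x \<in> spinors"
proof -
  have "gen k x S = 0" if "k < 14" "\<not> S \<subseteq> {..<7}" for k S
    using gen_spinors[OF assms that(1)] that(2) by (auto simp: spinors_def)
  then show ?thesis by (simp add: spinors_def clifford_eq[OF assms])
qed

lemma clifford_basis:
  assumes "x \<in> spinors" "l < 14"
  shows "clifford (basis_vec l) x = gen l x"
proof
  fix S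
  have "(\<Sum>k<14. q (basis_vec l) (dual_vec k) * gen k x S) = (\<Sum>k<14. if k = l then gen k x S else 0)"
    by (rule sum.cong) (use assms in \<open>auto simp: q_basis_dual\<close>)
  then show "clifford (basis_vec l) x S = gen l x S"
    using assms by (simp add: clifford_eq)
qed

lemma clifford_comb:
  assumes "x \<in> spinors"
  shows "clifford (u + c *s v) x S = clifford u x S + c * clifford v x S"
  by (simp add: clifford_eq[OF assms] q_add q_scale sum.distrib sum_distrib_left algebra_simps)

lemma spinors_comb: "x \<in> spinors \<Longrightarrow> y \<in> spinors \<Longrightarrow> (\<lambda>S. x S + c * y S) \<in> spinors"
  by (simp add: spinors_def)

lemma clifford_linear:
  assumes "x \<in> spinors" "y \<in> spinors"
  shows "clifford u (\<lambda>S. x S + c * y S) S = clifford u x S + c * clifford u y S"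
  by (simp add: clifford_eq[OF assms(1)] clifford_eq[OF assms(2)] clifford_eq[OF spinors_comb[OF assms]]
      gen_add sum.distrib sum_distrib_left algebra_simps)

lemma q_expand: "q u v = (\<Sum>k<14. q u (dual_vec k) * q v (basis_vec k))"
  using linear_form_expand(1)[OF linear_form_q, of u v] by (simp add: q_sym[of v])

lemma clifford_clifford:
  assumes x: "x \<in> spinors"
  shows "clifford u (clifford v x) S + clifford v (clifford u x) S = 2 * q u v * x S"
proof -
  have cc: "clifford u (clifford v x) S
      = (\<Sum>k<14. \<Sum>l<14. q u (dual_vec k) * q v (dual_vec l) * gen k (gen l x) S)" for u v
  proof -
    have "clifford u (clifford v x) S = (\<Sum>k<14. q u (dual_vec k) * gen k (clifford v x) S)"
      by (simp add: clifford_eq[OF clifford_spinors[OF x]])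
    then show ?thesis
      by (simp only: clifford_eq[OF x] gen_sum sum_distrib_left mult.assoc)
  qed
  have "clifford v (clifford u x) S
      = (\<Sum>k<14. \<Sum>l<14. q u (dual_vec k) * q v (dual_vec l) * gen l (gen k x) S)"
    unfolding cc by (subst sum.swap) (simp add: mult_ac)
  then have "clifford u (clifford v x) S + clifford v (clifford u x) S
      = (\<Sum>k<14. \<Sum>l<14. q u (dual_vec k) * q v (dual_vec l)
          * (gen k (gen l x) S + gen l (gen k x) S))"
    unfolding cc by (simp add: sum.distrib distrib_left)
  also have "\<dots> = (\<Sum>k<14. \<Sum>l<14. if l = dual_index k
      then 2 * x S * (q u (dual_vec k) * q v (dual_vec l)) else 0)"
    by (intro sum.cong refl) (simp add: gen_gen)
  also have "\<dots> = 2 * x S * (\<Sum>k<14. q u (dual_vec k) * q v (basis_vec k))"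
    unfolding sum_distrib_left by (intro sum.cong refl) (simp add: basis_vec_eq)
  also have "\<dots> = 2 * q u v * x S" by (simp add: q_expand[symmetric])
  finally show ?thesis .
qed

lemma clifford_square: "x \<in> spinors \<Longrightarrow> clifford u (clifford u x) = (\<lambda>S. q u u * x S)"
  using clifford_clifford[of x u u] by (intro ext) simp

lemma clifford_swap:
  "x \<in> spinors \<Longrightarrow> clifford u (clifford v x) = (\<lambda>S. 2 * q u v * x S + (-1) * clifford v (clifford u x) S)"
  using clifford_clifford[of x u v] by (intro ext) (simp add: algebra_simps)

section \<open>Self-adjointness of Clifford multiplication and the trilinear form of a
  spinor\<close>

lemma pairing_clifford:
  assumes "x \<in> spinors" "y \<in> spinors"
  shows "spin_pairing (clifford u x) y = spin_pairing x (clifford u y)"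
proof -
  have "spin_pairing (clifford u x) y = - (\<Sum>k<14. q u (dual_vec k) * spin_pairing y (gen k x))"
    by (subst pairing_antisym) (simp add: clifford_eq[OF assms(1)] pairing_sum_right)
  also have "\<dots> = (\<Sum>k<14. q u (dual_vec k) * spin_pairing x (gen k y))"
    unfolding sum_negf[symmetric]
    by (rule sum.cong) (simp_all add: pairing_gen[symmetric] pairing_antisym[of y])
  also have "\<dots> = spin_pairing x (clifford u y)"
    by (simp add: clifford_eq[OF assms(2)] pairing_sum_right)
  finally show ?thesis .
qed

text \<open>A self-adjoint operator for a skew pairing: the value equals its own negative.\<close>

lemma pairing_clifford_self: "x \<in> spinors \<Longrightarrow> spin_pairing x (clifford u x) = 0"
  using pairing_clifford[of x x u] pairing_antisym[of "clifford u x" x] by simp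

text \<open>No skew-symmetrization is needed: exchanging neighbours costs a multiple of some <x, u
  x>, which is zero, so the plain product is already alternating.\<close>

definition tri :: "(nat set \<Rightarrow> complex) \<Rightarrow> 'v \<Rightarrow> 'v \<Rightarrow> 'v \<Rightarrow> complex" where
  "tri x u v w = spin_pairing x (clifford u (clifford v (clifford w x)))"

lemma tri_swap12:
  assumes "x \<in> spinors"
  shows "tri x v u w = - tri x u v w"
  by (simp only: tri_def clifford_swap[of "clifford w x" u v] clifford_spinors assms pairing_add_right
      pairing_scale_right pairing_clifford_self) simp

lemma tri_swap23:
  assumes x: "x \<in> spinors"
  shows "tri x u w v = - tri x u v w"
proof -
  have "clifford u (clifford v (clifford w x))
      = clifford u (\<lambda>S. 2 * q v w * x S + (-1) * clifford w (clifford v x) S)"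
    by (simp add: clifford_swap[OF x, of v w])
  also have "\<dots> = (\<lambda>S. 2 * q v w * clifford u x S + (-1) * clifford u (clifford w (clifford v x)) S)"
  proof
    fix S
    have "(\<lambda>S. 2 * q v w * x S) \<in> spinors" using x by (simp add: spinors_def)
    \<comment> \<open>The zero spinor turns \<open>clifford_linear\<close>, stated for x + c y, into
      compatibility with scalars.\<close>
    moreover have "(\<lambda>S. 0) \<in> spinors" by (simp add: spinors_def)
    ultimately show "clifford u (\<lambda>S. 2 * q v w * x S + (-1) * clifford w (clifford v x) S) S
      = 2 * q v w * clifford u x S + (-1) * clifford u (clifford w (clifford v x)) S"
      using clifford_linear[of "\<lambda>S. 2 * q v w * x S" "clifford w (clifford v x)" u "-1" S]
        clifford_linear[of "\<lambda>S. 0" x u "2 * q v w" S] x clifford_spinors[OF clifford_spinors[OF x]]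
        clifford_linear[of "\<lambda>S. 0" "\<lambda>S. 0" u 1 S]
      by simp
  qed
  finally show ?thesis
    by (simp only: tri_def pairing_add_right pairing_scale_right pairing_clifford_self[OF x]) simp
qed

lemma tri_diag: "x \<in> spinors \<Longrightarrow> tri x u u w = 0"
  using tri_swap12[of x u u w] by simp

lemma clifford_comb_fun:
  "x \<in> spinors \<Longrightarrow> clifford (u + c *s v) x = (\<lambda>S. clifford u x S + c * clifford v x S)"
  by (intro ext clifford_comb)

lemma linear_form_tri1: "x \<in> spinors \<Longrightarrow> linear_form (\<lambda>u. tri x u v w)"
  by (rule linear_formI)
    (simp only: tri_def clifford_comb_fun[of "clifford v (clifford w x)"] clifford_spinors
      pairing_add_right)

lemma linear_form_cmult: "linear_form \<phi> \<Longrightarrow> linear_form (\<lambda>u. c * \<phi> u)"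
  by (simp add: linear_form_def algebra_simps)

lemma linear_form_cmult_right: "linear_form \<phi> \<Longrightarrow> linear_form (\<lambda>u. \<phi> u * c)"
  by (simp add: linear_form_def algebra_simps)

lemma linear_form_sum_form:
  "(\<And>i. i \<in> I \<Longrightarrow> linear_form (\<phi> i)) \<Longrightarrow> linear_form (\<lambda>u. \<Sum>i\<in>I. \<phi> i u)"
  by (simp add: linear_form_def sum.distrib sum_distrib_left)

lemma linear_form_tri2:
  assumes "x \<in> spinors"
  shows "linear_form (\<lambda>v. tri x u v w)"
  using linear_form_cmult[OF linear_form_tri1[OF assms], of "-1" u w]
  by (simp add: tri_swap12[OF assms, symmetric])

lemma linear_form_tri3:
  assumes "x \<in> spinors"
  shows "linear_form (\<lambda>w. tri x u v w)"
  using linear_form_cmult[OF linear_form_tri2[OF assms], of "-1" u v]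
  by (simp add: tri_swap23[OF assms, symmetric])

end

section \<open>The endomorphism \<open>M\<^sub>z\<close> and its equivariance\<close>

text \<open>The unit of the exterior algebra, from which \<open>create\<close> builds all wedge
  products of basis vectors.\<close>

definition vac :: "nat set \<Rightarrow> complex" where
  "vac S = (if S = {} then 1 else 0)"

lemma create_vac: "create q vac S = (if S = {q} then 1 else 0)"
proof (cases "q \<in> S")
  case True
  then have "S - {q} = {} \<longleftrightarrow> S = {q}" by auto
  moreover have "sg q {q} = 1" by (simp add: sg_insert) (simp add: sg_def)
  ultimately show ?thesis using True by (simp add: create_def vac_def)
qed (auto simp: create_def)

definition delta :: "nat \<Rightarrow> nat \<Rightarrow> complex" where
  "delta a i = (if i = a then 1 else 0)"

lemma create_pair:
  assumes "a < b"
  shows "create p (create q vac) {a, b}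
    = delta a p * delta b q - delta b p * delta a q"
proof -
  have "sg a {a, b} = 1" "sg b {a, b} = -1" using assms by (simp_all add: sg_insert, simp_all add: sg_def)
  moreover have "{a, b} - {a} = {b}" "{a, b} - {b} = {a}" using assms by auto
  ultimately show ?thesis using assms by (auto simp: create_def[of p] create_vac delta_def)
qed

definition delta3 :: "nat \<Rightarrow> nat \<Rightarrow> nat \<Rightarrow> nat \<Rightarrow> nat \<Rightarrow> nat \<Rightarrow> complex" where
  "delta3 a b c i j k = delta a i * delta b j * delta c k"

text \<open>The coordinate is a 3 by 3 determinant of Kronecker deltas, written out over the six
  permutations.\<close>

lemma create_triple:
  assumes "a < b" "b < c"
  shows "create i (create j (create k vac)) {a, b, c} =
    delta3 a b c i j k - delta3 a c b i j k - delta3 b a c i j k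
    + delta3 b c a i j k + delta3 c a b i j k - delta3 c b a i j k"
proof -
  have "sg a {a, b, c} = 1" "sg b {a, b, c} = -1" "sg c {a, b, c} = 1"
    using assms by (simp_all add: sg_insert, simp_all add: sg_def)
  moreover have "{a, b, c} - {a} = {b, c}" "{a, b, c} - {b} = {a, c}" "{a, b, c} - {c} = {a, b}"
    using assms by auto
  moreover have "a < c" using assms by simp
  ultimately show ?thesis using assms
    by (simp add: create_def[of i] create_pair delta3_def) (auto simp: delta_def)
qed

lemma sum_delta3:
  assumes "a < n" "b < n" "c < n"
  shows "(\<Sum>i<n. \<Sum>j<n. \<Sum>k<n. h i j k * delta3 a b c i j k) = h a b c"
proof -
  have "(\<Sum>k<n. h i j k * delta3 a b c i j k) = (if i = a \<and> j = b then h a b c else 0)" for i j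
  proof -
    have "(\<Sum>k<n. h i j k * delta3 a b c i j k)
      = (\<Sum>k<n. if k = c then (if i = a \<and> j = b then h a b c else 0) else 0)"
      by (rule sum.cong) (auto simp: delta3_def delta_def)
    then show ?thesis using assms by simp
  qed
  moreover have "(\<Sum>j<n. if i = a \<and> j = b then h a b c else 0) = (if i = a then h a b c else 0)" for i
    using assms by (cases "i = a") simp_all
  ultimately show ?thesis using assms by simp
qed

text \<open>The six permutations contribute equally once signs are taken into account; the factor 6
  cancels the 1/6 of \<open>sum_strict_triples\<close>.\<close>

lemma sum_alternating_delta3:
  assumes abc: "a < n" "b < n" "c < n"
    and swap12: "\<And>i j k. h j i k = - h i j k" and swap23: "\<And>i j k. h i k j = - h i j k"
  shows "(\<Sum>i<n. \<Sum>j<n. \<Sum>k<n. h i j k *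
      (delta3 a b c i j k - delta3 a c b i j k - delta3 b a c i j k
      + delta3 b c a i j k + delta3 c a b i j k - delta3 c b a i j k)) = 6 * h a b c"
proof -
  have "h a c b = - h a b c" "h b a c = - h a b c" "h b c a = h a b c" "h c a b = h a b c"
    "h c b a = - h a b c"
    using swap23[of a b c] swap12[of b a c] swap12[of a c b] swap23[of b a c] swap12[of b c a]
      swap23[of a b c] by simp_all
  moreover have "(\<Sum>i<n. \<Sum>j<n. \<Sum>k<n. h i j k *
      (delta3 a b c i j k - delta3 a c b i j k - delta3 b a c i j k
      + delta3 b c a i j k + delta3 c a b i j k - delta3 c b a i j k))
    = h a b c - h a c b - h b a c + h b c a + h c a b - h c b a"
    by (simp only: distrib_left right_diff_distrib sum.distrib sum_subtractf sum_delta3 abc)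
  ultimately show ?thesis by simp
qed

lemma sum_dual_index3:
  "(\<Sum>i<14. \<Sum>j<14. \<Sum>k<14. h (dual_index i) (dual_index j) (dual_index k))
    = (\<Sum>i<14. \<Sum>j<14. \<Sum>k<14. h i j k)"
  by (simp only: sum_dual_index[of "\<lambda>k. h _ _ k"] sum_dual_index[of "\<lambda>j. \<Sum>k<14. h _ j k"]
      sum_dual_index[of "\<lambda>i. \<Sum>j<14. \<Sum>k<14. h i j k"])

lemma pairing_plus_right: "spin_pairing x (\<lambda>S. y S + z S) = spin_pairing x y + spin_pairing x z"
  using pairing_add_right[of x y 1 z] by simp

lemma pairing_minus_right: "spin_pairing x (\<lambda>S. y S - z S) = spin_pairing x y - spin_pairing x z"
  using pairing_add_right[of x y "-1" z] by simp

context split_quadratic_space_14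
begin

section \<open>Coordinates of \<open>Omega\<close>, of its polarization and of
  \<open>q2\<close>\<close>

lemma vec_in_ext_basis: "p < 14 \<Longrightarrow> vec_in_ext (basis_vec p) = create p vac"
proof
  fix S assume p: "p < 14"
  have "vec_in_ext (basis_vec p) S = (\<Sum>i<14. if i = p then (if S = {p} then 1 else 0) else 0)"
    unfolding vec_in_ext_def ext_vec_def by (rule sum.cong) (use p in \<open>auto simp: q_basis_dual\<close>)
  then show "vec_in_ext (basis_vec p) S = create p vac S" using p by (simp add: create_vac)
qed

lemma wedge_vec_in_ext:
  assumes "p < 14" "finite S"
  shows "wedge (vec_in_ext (basis_vec p)) y S = create p y S"
proof -
  have "wedge (vec_in_ext (basis_vec p)) y S
      = (\<Sum>i\<in>S \<inter> {..<14}. if i = p then sg p S * y (S - {p}) else 0)"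
    unfolding vec_in_ext_def wedge_ext_vec[OF assms(2)]
    by (rule sum.cong) (use assms in \<open>auto simp: q_basis_dual\<close>)
  then show ?thesis using assms by (simp add: create_def)
qed

lemma wedge_basis_pair:
  assumes "p < 14" "p' < 14" "finite S"
  shows "wedge (vec_in_ext (basis_vec p)) (vec_in_ext (basis_vec p')) S = create p (create p' vac) S"
  using assms by (simp only: wedge_vec_in_ext vec_in_ext_basis[of p'])

lemma wedge_basis_triple:
  assumes "p < 14" "p' < 14" "p'' < 14" "finite S"
  shows "wedge (vec_in_ext (basis_vec p)) (wedge (vec_in_ext (basis_vec p'))
    (vec_in_ext (basis_vec p''))) S = create p (create p' (create p'' vac)) S"
proof -
  have "finite (S - {p})" using assms by simp
  then show ?thesis using assms
    by (simp only: wedge_vec_in_ext create_def[of p] vec_in_ext_basis[of p''])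
qed

lemma pairing_skew_clifford:
  assumes x: "x \<in> spinors"
  shows "spin_pairing x (skew_clifford u v w x) = tri x u v w"
proof -
  have "spin_pairing x (skew_clifford u v w x)
    = 1/6 * (tri x u v w + tri x v w u + tri x w u v - tri x v u w - tri x u w v - tri x w v u)"
    unfolding skew_clifford_def tri_def
    by (simp only: pairing_scale_right pairing_plus_right pairing_minus_right)
  moreover have "tri x v w u = - tri x v u w" "tri x u w v = - tri x u v w"
    by (rule tri_swap23[OF x])+
  moreover have "tri x v u w = - tri x u v w" "tri x w u v = - tri x u w v" "tri x w v u = - tri x v w u"
    by (rule tri_swap12[OF x])+
  ultimately show ?thesis by (simp only:) simp
qed

definition dual_tri :: "(nat set \<Rightarrow> complex) \<Rightarrow> nat \<Rightarrow> nat \<Rightarrow> nat \<Rightarrow> complex" where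
  "dual_tri x i j k = tri x (dual_vec i) (dual_vec j) (dual_vec k)"

lemma dual_tri_swap12: "x \<in> spinors \<Longrightarrow> dual_tri x j i k = - dual_tri x i j k"
  unfolding dual_tri_def by (rule tri_swap12)

lemma dual_tri_swap23: "x \<in> spinors \<Longrightarrow> dual_tri x i k j = - dual_tri x i j k"
  unfolding dual_tri_def by (rule tri_swap23)

lemma dual_tri_diag: "x \<in> spinors \<Longrightarrow> dual_tri x i i k = 0" "x \<in> spinors \<Longrightarrow> dual_tri x i k k = 0"
  using dual_tri_swap12[of x i i k] dual_tri_swap23[of x i k k] by simp_all

text \<open>\<open>Omega\<close> attaches the value at v_i, v_j, v_k to the wedge of the dual
  vectors; reindexing by \<open>dual_index\<close> moves the duals into the trilinear form.\<close>

lemma Omega_coeff: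
  assumes x: "x \<in> spinors" and abc: "a < b" "b < c" "c < 14"
  shows "Omega x {a, b, c} = dual_tri x a b c"
proof -
  define W where "W i j k = create i (create j (create k vac)) {a, b, c}" for i j k
  have W12: "W j i k = - W i j k" for i j k
    using create_create[of i j "create k vac" "{a, b, c}"] by (simp add: W_def eq_neg_iff_add_eq_0 add.commute)
  have W23: "W i k j = - W i j k" for i j k
    using create_create[of j k vac] by (simp add: W_def create_def[of i] eq_neg_iff_add_eq_0
        distrib_left[symmetric] add.commute)
  define g where "g i j k = tri x (basis_vec i) (basis_vec j) (basis_vec k)
    * W (dual_index i) (dual_index j) (dual_index k)" for i j k
  have "Omega x {a, b, c} = (\<Sum>k<14. \<Sum>j<k. \<Sum>i<j. g i j k)"
    unfolding Omega_def
  proof (intro sum.cong refl)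
    fix k j i assume "k \<in> {..<14::nat}" "j \<in> {..<k}" "i \<in> {..<j}"
    then show "spin_pairing x (skew_clifford (basis_vec i) (basis_vec j) (basis_vec k) x) *
        wedge (vec_in_ext (dual_vec i)) (wedge (vec_in_ext (dual_vec j)) (vec_in_ext (dual_vec k)))
          {a, b, c} = g i j k"
      by (simp add: g_def W_def pairing_skew_clifford[OF x] dual_vec_eq wedge_basis_triple)
  qed
  also have "\<dots> = 1/6 * (\<Sum>i<14. \<Sum>j<14. \<Sum>k<14. g i j k)"
  proof (rule sum_strict_triples)
    show "g i j k = g j i k" for i j k
      using W12[of "dual_index i" "dual_index j" "dual_index k"]
      by (simp add: g_def tri_swap12[OF x, of "basis_vec j" "basis_vec i"])
    show "g i j k = g i k j" for i j k
      using W23[of "dual_index i" "dual_index j" "dual_index k"]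
      by (simp add: g_def tri_swap23[OF x, of _ "basis_vec k" "basis_vec j"])
    show "g i i k = 0" for i k by (simp add: g_def tri_diag[OF x])
  qed
  also have "(\<Sum>i<14. \<Sum>j<14. \<Sum>k<14. g i j k) = (\<Sum>i<14. \<Sum>j<14. \<Sum>k<14.
      dual_tri x (dual_index i) (dual_index j) (dual_index k)
      * W (dual_index i) (dual_index j) (dual_index k))"
    by (intro sum.cong refl) (simp add: g_def dual_tri_def basis_vec_eq)
  also have "\<dots> = (\<Sum>i<14. \<Sum>j<14. \<Sum>k<14. dual_tri x i j k * W i j k)"
    by (rule sum_dual_index3)
  also have "\<dots> = 6 * dual_tri x a b c"
    unfolding W_def create_triple[OF abc(1,2)]
    by (rule sum_alternating_delta3[OF _ _ _ dual_tri_swap12[OF x] dual_tri_swap23[OF x]])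
      (use abc in simp_all)
  finally show ?thesis by simp
qed

lemma polarization_Omega:
  assumes x: "x \<in> spinors" and ab: "a < b" "b < 14" and l: "l < 14"
  shows "polarization (Omega x) l {a, b} = dual_tri x l a b"
proof -
  define W where "W i j = create i (create j vac) {a, b}" for i j
  have W: "W j i = - W i j" for i j
    using create_create[of i j vac "{a, b}"] by (simp add: W_def eq_neg_iff_add_eq_0 add.commute)
  define h where "h i j k = delta l i * W j k + delta l j * W k i + delta l k * W i j" for i j k
  \<comment> \<open>The cyclic polarization is the Laplace expansion of a 3 by 3 determinant along
    the index \<open>l\<close>, so alternating coefficients collapse as they do for
    \<open>Omega\<close>.\<close>
  have h: "h i j k = delta3 a b l i j k - delta3 a l b i j k - delta3 b a l i j k
    + delta3 b l a i j k + delta3 l a b i j k - delta3 l b a i j k" for i j k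
    unfolding h_def W_def create_pair[OF ab(1)] delta3_def by (simp only: algebra_simps)
  have "polarization (Omega x) l {a, b} = (\<Sum>k<14. \<Sum>j<k. \<Sum>i<j. dual_tri x i j k * h i j k)"
    unfolding polarization_def
  proof (intro sum.cong refl)
    fix k j i assume "k \<in> {..<14::nat}" "j \<in> {..<k}" "i \<in> {..<j}"
    then show "Omega x {i, j, k} * polarize_wedge (basis_vec i) (basis_vec j) (basis_vec k) l {a, b}
        = dual_tri x i j k * h i j k"
      using l by (simp add: Omega_coeff[OF x] polarize_wedge_def vec_tensor_def wedge_basis_pair
          q_basis_dual h_def delta_def W_def)
  qed
  also have "\<dots> = 1/6 * (\<Sum>i<14. \<Sum>j<14. \<Sum>k<14. dual_tri x i j k * h i j k)"
  proof (rule sum_strict_triples)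
    show "dual_tri x i j k * h i j k = dual_tri x j i k * h j i k" for i j k
      using W[of i j] W[of j k] W[of k i]
      by (simp add: h_def dual_tri_swap12[OF x, of j i] algebra_simps)
    show "dual_tri x i j k * h i j k = dual_tri x i k j * h i k j" for i j k
      using W[of i j] W[of j k] W[of k i]
      by (simp add: h_def dual_tri_swap23[OF x, of i k j] algebra_simps)
    show "dual_tri x i i k * h i i k = 0" for i k by (simp add: dual_tri_diag[OF x])
  qed
  also have "(\<Sum>i<14. \<Sum>j<14. \<Sum>k<14. dual_tri x i j k * h i j k) = 6 * dual_tri x a b l"
    unfolding h by (rule sum_alternating_delta3[OF _ _ _ dual_tri_swap12[OF x] dual_tri_swap23[OF x]])
      (use ab l in simp_all)
  also have "dual_tri x a b l = dual_tri x l a b"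
    using dual_tri_swap23[OF x, of a l b] dual_tri_swap12[OF x, of a l b] by simp
  finally show ?thesis by simp
qed

text \<open>Contraction with \<open>q\<close> on the split basis replaces an index by its dual. Full
  sums count each pair twice, whence the 1/2.\<close>

lemma q2_alternating:
  assumes \<eta>: "\<And>a b. a < b \<Longrightarrow> b < 14 \<Longrightarrow> \<eta> {a, b} = A a b"
    and \<theta>: "\<And>a b. a < b \<Longrightarrow> b < 14 \<Longrightarrow> \<theta> {a, b} = B a b"
    and A: "\<And>a b. A b a = - A a b" and B: "\<And>a b. B b a = - B a b"
  shows "q2 \<eta> \<theta> = 1/2 * (\<Sum>a<14. \<Sum>b<14. A a b * B (dual_index a) (dual_index b))"
proof -
  have diag: "A a a = 0" "B a a = 0" for a using A[of a a] B[of a a] by simp_all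
  \<comment> \<open>The Gram determinant of two wedges of basis vectors; it is alternating in
    \<open>c\<close> and \<open>d\<close>.\<close>
  define K where "K a b c d = (if c = dual_index a \<and> d = dual_index b then 1 else 0)
    - (if d = dual_index a \<and> c = dual_index b then 1 else 0 :: complex)" for a b c d
  have inner: "(\<Sum>d<14. \<Sum>c<d. B c d * K a b c d) = B (dual_index a) (dual_index b)"
    if "a < 14" "b < 14" for a b
  proof -
    have row: "(\<Sum>d<14. B c d * K a b c d) = (if c = dual_index a then B c (dual_index b) else 0)
        - (if c = dual_index b then B c (dual_index a) else 0)" for c
    proof -
      have "(\<Sum>d<14. B c d * K a b c d)
          = (\<Sum>d<14. if d = dual_index b then (if c = dual_index a then B c d else 0) else 0)
          - (\<Sum>d<14. if d = dual_index a then (if c = dual_index b then B c d else 0) else 0)"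
        unfolding sum_subtractf[symmetric] by (rule sum.cong) (auto simp: K_def)
      then show ?thesis using that by simp
    qed
    have "(\<Sum>d<14. \<Sum>c<d. B c d * K a b c d) = 1/2 * (\<Sum>c<14. \<Sum>d<14. B c d * K a b c d)"
    proof (rule sum_strict_pairs)
      show "B c d * K a b c d = B d c * K a b d c" for c d
      proof -
        have "K a b d c = - K a b c d" by (simp only: K_def minus_diff_eq)
        then show ?thesis by (simp only: B[of c d] mult_minus_left mult_minus_right)
      qed
    qed (simp add: diag)
    also have "(\<Sum>c<14. \<Sum>d<14. B c d * K a b c d)
        = (\<Sum>c<14. (if c = dual_index a then B c (dual_index b) else 0)
        - (if c = dual_index b then B c (dual_index a) else 0))"
      by (simp only: row)
    also have "\<dots> = 2 * B (dual_index a) (dual_index b)"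
      using that B[of "dual_index a" "dual_index b"] by (simp add: sum_subtractf)
    finally show ?thesis by simp
  qed
  have "q2 \<eta> \<theta> = (\<Sum>b<14. \<Sum>a<b. A a b * (\<Sum>d<14. \<Sum>c<d. B c d * K a b c d))"
    unfolding q2_def sum_distrib_left
  proof (intro sum.cong refl)
    fix b a d c assume "b \<in> {..<14::nat}" "a \<in> {..<b}" "d \<in> {..<14::nat}" "c \<in> {..<d}"
    then show "\<eta> {a, b} * \<theta> {c, d} * (q (basis_vec a) (basis_vec c) * q (basis_vec b) (basis_vec d)
        - q (basis_vec a) (basis_vec d) * q (basis_vec b) (basis_vec c))
      = A a b * (B c d * K a b c d)"
      by (simp add: \<eta> \<theta> q_basis K_def)
  qed
  also have "\<dots> = (\<Sum>b<14. \<Sum>a<b. A a b * B (dual_index a) (dual_index b))"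
    by (intro sum.cong refl) (simp add: inner)
  also have "\<dots> = 1/2 * (\<Sum>a<14. \<Sum>b<14. A a b * B (dual_index a) (dual_index b))"
  proof (rule sum_strict_pairs)
    show "A a b * B (dual_index a) (dual_index b) = A b a * B (dual_index b) (dual_index a)" for a b
      using A[of a b] B[of "dual_index a" "dual_index b"] by simp
  qed (simp add: diag)
  finally show ?thesis .
qed

text \<open>Two copies of the trilinear form contracted in their last two slots. By
  \<open>q_M_endo\<close> it is twice the bilinear form of the endomorphism.\<close>

definition quart :: "(nat set \<Rightarrow> complex) \<Rightarrow> 'v \<Rightarrow> 'v \<Rightarrow> complex" where
  "quart x u v = (\<Sum>a<14. \<Sum>b<14. tri x u (dual_vec a) (dual_vec b) * tri x v (basis_vec a) (basis_vec b))"

lemma linear_form_quart1: "x \<in> spinors \<Longrightarrow> linear_form (\<lambda>u. quart x u v)"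
  unfolding quart_def by (intro linear_form_sum_form linear_form_cmult_right linear_form_tri1)

lemma linear_form_quart2: "x \<in> spinors \<Longrightarrow> linear_form (\<lambda>v. quart x u v)"
  unfolding quart_def by (intro linear_form_sum_form linear_form_cmult linear_form_tri1)

lemma M_endo_eq:
  assumes x: "x \<in> spinors"
  shows "M_endo x u = (\<Sum>i<14. (1/2 * quart x (dual_vec i) u) *s basis_vec i)"
proof -
  have "q2 (polarization (Omega x) i) (polarization (Omega x) j)
      = 1/2 * quart x (dual_vec i) (dual_vec j)" if "i < 14" "j < 14" for i j
  proof -
    have "q2 (polarization (Omega x) i) (polarization (Omega x) j) = 1/2 *
        (\<Sum>a<14. \<Sum>b<14. dual_tri x i a b * dual_tri x j (dual_index a) (dual_index b))"
      by (rule q2_alternating[OF _ _ dual_tri_swap23[OF x] dual_tri_swap23[OF x]])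
        (simp_all add: polarization_Omega[OF x] that)
    also have "(\<Sum>a<14. \<Sum>b<14. dual_tri x i a b * dual_tri x j (dual_index a) (dual_index b))
        = quart x (dual_vec i) (dual_vec j)"
      unfolding quart_def by (intro sum.cong refl) (simp add: dual_tri_def basis_vec_eq)
    finally show ?thesis .
  qed
  then have "M_endo x u = (\<Sum>i<14. \<Sum>j<14.
      (1/2 * quart x (dual_vec i) (dual_vec j) * q (basis_vec j) u) *s basis_vec i)"
    unfolding M_endo_def Theta_def by (intro sum.cong refl) simp
  also have "\<dots> = (\<Sum>i<14. (1/2 * quart x (dual_vec i) u) *s basis_vec i)"
  proof (intro sum.cong refl)
    fix i :: nat
    have "(\<Sum>j<14. (1/2 * quart x (dual_vec i) (dual_vec j) * q (basis_vec j) u) *s basis_vec i)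
      = (1/2 * (\<Sum>j<14. q u (basis_vec j) * quart x (dual_vec i) (dual_vec j))) *s basis_vec i"
      by (simp add: scale_sum_left sum_distrib_left q_sym[of u] mult_ac)
    then show "(\<Sum>j<14. (1/2 * quart x (dual_vec i) (dual_vec j) * q (basis_vec j) u) *s basis_vec i)
      = (1/2 * quart x (dual_vec i) u) *s basis_vec i"
      by (simp add: linear_form_expand(2)[OF linear_form_quart2[OF x]])
  qed
  finally show ?thesis .
qed

lemma q_M_endo:
  assumes x: "x \<in> spinors"
  shows "q (M_endo x u) v = 1/2 * quart x v u"
proof -
  have "q (M_endo x u) v = 1/2 * (\<Sum>i<14. q v (basis_vec i) * quart x (dual_vec i) u)"
    by (simp add: M_endo_eq[OF x] q_sum_left q_scale sum_distrib_left q_sym[of v] mult_ac)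
  then show ?thesis by (simp add: linear_form_expand(2)[OF linear_form_quart1[OF x]])
qed

section \<open>Equivariance under a single unit vector\<close>

lemma linear_form_clifford: "x \<in> spinors \<Longrightarrow> linear_form (\<lambda>u. clifford u x S)"
  by (rule linear_formI) (rule clifford_comb)

lemma clifford_unit: "q r r = 1 \<Longrightarrow> x \<in> spinors \<Longrightarrow> clifford r (clifford r x) = x"
  by (simp add: clifford_square)

lemma clifford_reflection:
  assumes x: "x \<in> spinors" and r: "q r r = 1"
  shows "clifford (reflection r u) x = clifford r (clifford u (clifford r x))"
proof
  fix S
  have "clifford (reflection r u) x S = 2 * q r u * clifford r x S - clifford u x S"
    by (rule linear_form_reflection[OF linear_form_clifford[OF x]])
  moreover have "clifford r (clifford u (clifford r x)) S + clifford u (clifford r (clifford r x)) S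
      = 2 * q r u * clifford r x S"
    by (rule clifford_clifford[OF clifford_spinors[OF x]])
  then have "clifford r (clifford u (clifford r x)) S = 2 * q r u * clifford r x S - clifford u x S"
    by (simp add: eq_diff_eq clifford_unit[OF r x])
  ultimately show "clifford (reflection r u) x S = clifford r (clifford u (clifford r x)) S"
    by (simp only:)
qed

text \<open>The outer factor \<open>clifford r\<close> moves across the pairing, and inserting r r =
  1 between the remaining factors conjugates each vector by \<open>r\<close>.\<close>

lemma tri_clifford:
  assumes x: "x \<in> spinors" and r: "q r r = 1"
  shows "tri (clifford r x) u v w = tri x (reflection r u) (reflection r v) (reflection r w)"
  using x by (simp add: tri_def pairing_clifford clifford_spinors clifford_reflection[OF _ r] clifford_unit[OF r])

text \<open>\<open>dual_basis_reflection\<close> removes the reflection from the two contracted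
  slots, one after the other.\<close>

lemma quart_clifford:
  assumes x: "x \<in> spinors" and r: "q r r = 1"
  shows "quart (clifford r x) u v = quart x (reflection r u) (reflection r v)"
proof -
  let ?R = "reflection r"
  have "quart (clifford r x) u v = (\<Sum>a<14. \<Sum>b<14.
      tri x (?R u) (?R (dual_vec a)) (?R (dual_vec b)) * tri x (?R v) (?R (basis_vec a)) (?R (basis_vec b)))"
    by (simp add: quart_def tri_clifford[OF x r])
  also have "\<dots> = (\<Sum>a<14. \<Sum>b<14.
      tri x (?R u) (?R (dual_vec a)) (dual_vec b) * tri x (?R v) (?R (basis_vec a)) (basis_vec b))"
    by (rule sum.cong[OF refl], rule dual_basis_reflection[of "\<lambda>c d. tri x _ _ d * tri x _ _ c"])
      (intro linear_form_cmult linear_form_cmult_right linear_form_tri3 x r)+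
  also have "\<dots> = (\<Sum>b<14. \<Sum>a<14.
      tri x (?R u) (?R (dual_vec a)) (dual_vec b) * tri x (?R v) (?R (basis_vec a)) (basis_vec b))"
    by (rule sum.swap)
  also have "\<dots> = (\<Sum>b<14. \<Sum>a<14.
      tri x (?R u) (dual_vec a) (dual_vec b) * tri x (?R v) (basis_vec a) (basis_vec b))"
    by (rule sum.cong[OF refl], rule dual_basis_reflection[of "\<lambda>c d. tri x _ d _ * tri x _ c _"])
      (intro linear_form_cmult linear_form_cmult_right linear_form_tri2 x r)+
  also have "\<dots> = quart x (?R u) (?R v)"
    unfolding quart_def by (rule sum.swap)
  finally show ?thesis .
qed

text \<open>Reindexing both sums by \<open>dual_index\<close> exchanges the basis with its
  dual.\<close>

lemma quart_sym: "quart x u v = quart x v u"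
proof -
  have "quart x v u = (\<Sum>a<14. \<Sum>b<14.
      tri x u (dual_vec (dual_index a)) (dual_vec (dual_index b))
      * tri x v (basis_vec (dual_index a)) (basis_vec (dual_index b)))"
    unfolding quart_def by (intro sum.cong refl) (simp add: dual_vec_eq mult.commute)
  also have "\<dots> = quart x u v"
    unfolding quart_def
    by (simp only: sum_dual_index[of "\<lambda>b. tri x u _ (dual_vec b) * tri x v _ (basis_vec b)"]
      sum_dual_index[of "\<lambda>a. \<Sum>b<14. tri x u (dual_vec a) (dual_vec b) * tri x v (basis_vec a) (basis_vec b)"])
  finally show ?thesis ..
qed

lemma eq_if_q_eq: "(\<And>v. q a v = q b v) \<Longrightarrow> a = b"
  using q_nondegenerate[of "a - b"] by (simp add: q_diff_left)

lemma M_endo_clifford: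
  assumes x: "x \<in> spinors" and r: "q r r = 1"
  shows "M_endo (clifford r x) u = reflection r (M_endo x (reflection r u))"
proof (rule eq_if_q_eq)
  fix v
  have "q (reflection r (M_endo x (reflection r u))) v = q (reflection r (M_endo x (reflection r u))) (reflection r (reflection r v))"
    by (simp add: reflection_reflection[OF r])
  also have "\<dots> = 1/2 * quart x (reflection r v) (reflection r u)"
    by (simp add: q_reflection[OF r] q_M_endo[OF x])
  also have "\<dots> = q (M_endo (clifford r x) u) v"
    by (simp add: q_M_endo clifford_spinors x quart_clifford[OF x r])
  finally show "q (M_endo (clifford r x) u) v = q (reflection r (M_endo x (reflection r u))) v" ..
qed

text \<open>The bilinear form of the square, since the endomorphism is self-adjoint for
  \<open>q\<close> by \<open>quart_sym\<close>. In this form symmetry and the action of reflections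
  are immediate.\<close>

definition norm_form :: "(nat set \<Rightarrow> complex) \<Rightarrow> 'v \<Rightarrow> 'v \<Rightarrow> complex" where
  "norm_form x u v = q (M_endo x u) (M_endo x v)"

lemma norm_form_eq:
  assumes x: "x \<in> spinors"
  shows "norm_form x u v = 1/4 * (\<Sum>i<14. quart x (dual_vec i) u * quart x (basis_vec i) v)"
proof -
  have "norm_form x u v = (\<Sum>i<14. 1/2 * quart x (dual_vec i) u * q (M_endo x v) (basis_vec i))"
    by (simp add: norm_form_def M_endo_eq[OF x, of u] q_sum_left q_scale q_sym[of "basis_vec _"])
  then show ?thesis by (simp add: q_M_endo[OF x] sum_distrib_left)
qed

lemma linear_form_norm_form1: "x \<in> spinors \<Longrightarrow> linear_form (\<lambda>u. norm_form x u v)"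
  by (simp only: norm_form_eq)
    (intro linear_form_cmult linear_form_sum_form linear_form_cmult_right linear_form_quart2)

lemma linear_form_norm_form2: "x \<in> spinors \<Longrightarrow> linear_form (norm_form x u)"
proof -
  assume "x \<in> spinors"
  moreover have "norm_form x u = (\<lambda>v. norm_form x v u)"
    by (intro ext) (simp add: norm_form_def q_sym[of "M_endo x u"])
  ultimately show ?thesis using linear_form_norm_form1[of x u] by simp
qed

lemma norm_form_clifford:
  "x \<in> spinors \<Longrightarrow> q r r = 1 \<Longrightarrow> norm_form (clifford r x) u v = norm_form x (reflection r u) (reflection r v)"
  by (simp add: norm_form_def M_endo_clifford q_reflection)

section \<open>The normalized trace and the obstruction to a scalar square\<close>

definition octic :: "(nat set \<Rightarrow> complex) \<Rightarrow> complex" where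
  "octic x = 1/14 * (\<Sum>k<14. norm_form x (basis_vec k) (dual_vec k))"

lemma octic_clifford:
  assumes "x \<in> spinors" "q r r = 1"
  shows "octic (clifford r x) = octic x"
  unfolding octic_def norm_form_clifford[OF assms]
  using dual_basis_reflection[OF linear_form_norm_form1 linear_form_norm_form2, OF assms(1) assms(1) assms(2)]
  by simp

definition defect :: "'v \<Rightarrow> 'v \<Rightarrow> (nat set \<Rightarrow> complex) \<Rightarrow> complex" where
  "defect u v x = norm_form x u v - octic x * q u v"

lemma defect_clifford:
  "x \<in> spinors \<Longrightarrow> q r r = 1 \<Longrightarrow> defect u v (clifford r x) = defect (reflection r u) (reflection r v) x"
  by (simp add: defect_def norm_form_clifford octic_clifford q_reflection)

lemma M_endo_square:
  assumes x: "x \<in> spinors" and "\<And>u v. defect u v x = 0"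
  shows "M_endo x (M_endo x u) = octic x *s u"
proof (rule eq_if_q_eq)
  fix v
  have "q (M_endo x (M_endo x u)) v = 1/2 * quart x v (M_endo x u)" by (rule q_M_endo[OF x])
  also have "\<dots> = q (M_endo x v) (M_endo x u)" by (simp add: q_M_endo[OF x] quart_sym[of x v])
  also have "\<dots> = octic x * q u v"
    using assms(2)[of v u] by (simp add: defect_def norm_form_def q_sym[of v])
  finally show "q (M_endo x (M_endo x u)) v = q (octic x *s u) v" by (simp add: q_scale)
qed

section \<open>Homogeneity\<close>

lemma homogeneous_clifford:
  assumes "\<And>S. homogeneous_on_half_spin d (\<lambda>z. X z S)" "\<And>z. z \<in> half_spin \<Longrightarrow> X z \<in> spinors"
  shows "homogeneous_on_half_spin d (\<lambda>z. clifford u (X z) S)"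
proof (rule homogeneous_cong)
  have "homogeneous_on_half_spin d (\<lambda>z. gen k (X z) S)" for k
  proof -
    have "homogeneous_on_half_spin d (\<lambda>z. create k (X z) S)"
      by (cases "k \<in> S") (simp_all add: create_def homogeneous_zero homogeneous_cmult assms)
    moreover have "homogeneous_on_half_spin d (\<lambda>z. annihilate (k - 7) (X z) S)"
      by (cases "k - 7 \<in> S") (simp_all add: annihilate_def homogeneous_zero homogeneous_cmult assms)
    ultimately show ?thesis by (cases "k < 7") (simp_all add: gen_def homogeneous_cmult)
  qed
  then show "homogeneous_on_half_spin d (\<lambda>z. \<Sum>k<14. q u (dual_vec k) * gen k (X z) S)"
    by (intro homogeneous_sum homogeneous_cmult)
qed (simp add: clifford_eq assms)

lemma homogeneous_tri: "homogeneous_on_half_spin 2 (\<lambda>z. tri z u v w)"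
proof -
  have s: "z \<in> half_spin \<Longrightarrow> z \<in> spinors" for z using half_spin_subset_spinors by blast
  have "homogeneous_on_half_spin 1 (\<lambda>z. clifford u (clifford v (clifford w z)) S)" for S
    by (intro homogeneous_clifford homogeneous_coord clifford_spinors s)
  then have "homogeneous_on_half_spin (1 + 1) (\<lambda>z. pair_sign A * z A
      * clifford u (clifford v (clifford w z)) ({..<7} - A))" for A
    by (rule homogeneous_mult[OF homogeneous_cmult[OF homogeneous_coord]])
  then show ?thesis unfolding tri_def spin_pairing_eq one_add_one
    by (intro homogeneous_sum)
qed

lemma homogeneous_quart: "homogeneous_on_half_spin 4 (\<lambda>z. quart z u v)"
proof -
  have "homogeneous_on_half_spin (2 + 2) (\<lambda>z. tri z u a b * tri z v c d)" for a b c d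
    by (intro homogeneous_mult homogeneous_tri)
  then show ?thesis unfolding quart_def by (intro homogeneous_sum) simp
qed

lemma homogeneous_norm_form: "homogeneous_on_half_spin 8 (\<lambda>z. norm_form z u v)"
proof (rule homogeneous_cong)
  have "homogeneous_on_half_spin (4 + 4) (\<lambda>z. quart z a u * quart z b v)" for a b
    by (intro homogeneous_mult homogeneous_quart)
  then show "homogeneous_on_half_spin 8
      (\<lambda>z. 1/4 * (\<Sum>i<14. quart z (dual_vec i) u * quart z (basis_vec i) v))"
    by (intro homogeneous_cmult homogeneous_sum) simp
qed (use half_spin_subset_spinors in \<open>auto simp: norm_form_eq\<close>)

lemma homogeneous_octic: "homogeneous_on_half_spin 8 octic"
  unfolding octic_def[abs_def] by (intro homogeneous_cmult homogeneous_sum homogeneous_norm_form)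

lemma homogeneous_defect: "homogeneous_on_half_spin 8 (defect u v)"
proof -
  have "homogeneous_on_half_spin 8 (\<lambda>z. norm_form z u v + (- q u v) * octic z)"
    by (intro homogeneous_add homogeneous_cmult homogeneous_norm_form homogeneous_octic)
  then show ?thesis by (simp add: defect_def[abs_def] algebra_simps)
qed

lemma homogeneous_M_mat:
  assumes "i < 14" "j < 14"
  shows "homogeneous_on_half_spin 4 (\<lambda>z. M_mat z $$ (i, j))"
proof (rule homogeneous_cong)
  show "homogeneous_on_half_spin 4 (\<lambda>z. 1/2 * quart z (dual_vec i) (basis_vec j))"
    by (intro homogeneous_cmult homogeneous_quart)
qed (use half_spin_subset_spinors assms in \<open>auto simp: M_mat_def q_M_endo\<close>)

lemma M_mat_square:
  assumes x: "x \<in> spinors" and "\<And>u v. defect u v x = 0"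
  shows "M_mat x * M_mat x = octic x \<cdot>\<^sub>m 1\<^sub>m 14"
proof (rule eq_matI)
  fix i j assume "i < dim_row (octic x \<cdot>\<^sub>m 1\<^sub>m 14)" "j < dim_col (octic x \<cdot>\<^sub>m (1\<^sub>m 14 :: complex mat))"
  then have ij: "i < 14" "j < 14" by auto
  have lin: "linear_form (\<lambda>u. q (M_endo x u) v)" for v
    by (simp only: q_M_endo[OF x]) (intro linear_form_cmult linear_form_quart2 x)
  have "(M_mat x * M_mat x) $$ (i, j)
      = (\<Sum>k<14. q (M_endo x (basis_vec k)) (dual_vec i) * q (M_endo x (basis_vec j)) (dual_vec k))"
    using ij by (simp add: M_mat_def scalar_prod_def lessThan_atLeast0)
  also have "\<dots> = q (M_endo x (M_endo x (basis_vec j))) (dual_vec i)"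
    using linear_form_expand(1)[OF lin, of "M_endo x (basis_vec j)" "dual_vec i"]
    by (simp add: mult.commute)
  also have "\<dots> = (octic x \<cdot>\<^sub>m 1\<^sub>m 14) $$ (i, j)"
    using ij by (auto simp: M_endo_square[OF assms] q_scale q_basis_dual)
  finally show "(M_mat x * M_mat x) $$ (i, j) = (octic x \<cdot>\<^sub>m 1\<^sub>m 14) $$ (i, j)" .
qed (auto simp: M_mat_def)

section \<open>Parity\<close>

text \<open>\<open>True\<close> stands for even. One Clifford factor flips the parity, so only
  products of two preserve \<open>half_spin\<close>.\<close>

definition has_parity :: "bool \<Rightarrow> (nat set \<Rightarrow> complex) \<Rightarrow> bool" where
  "has_parity p x \<longleftrightarrow> (\<forall>S. S \<subseteq> {..<7} \<longrightarrow> even (card S) \<noteq> p \<longrightarrow> x S = 0)"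

lemma half_spin_iff: "x \<in> half_spin \<longleftrightarrow> x \<in> spinors \<and> has_parity True x"
  by (auto simp: half_spin_def spinors_def has_parity_def spin_coords_def)

lemma has_parity_gen:
  assumes x: "has_parity p x" and k: "k < 14"
  shows "has_parity (\<not> p) (gen k x)"
  unfolding has_parity_def
proof (intro allI impI)
  fix S :: "nat set" assume S: "S \<subseteq> {..<7}" "even (card S) \<noteq> (\<not> p)"
  have fin: "finite S" using S(1) by (rule finite_subset) simp
  show "gen k x S = 0"
  proof (cases "k < 7")
    case True
    have "x (S - {k}) = 0" if "k \<in> S"
    proof -
      have "card S = Suc (card (S - {k}))" using card.remove[OF fin that] by simp
      moreover have "S - {k} \<subseteq> {..<7}" using S(1) by auto
      ultimately show ?thesis using x S by (auto simp: has_parity_def)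
    qed
    then show ?thesis using True by (simp add: gen_def create_def)
  next
    case False
    have "x (insert (k - 7) S) = 0" if "k - 7 \<notin> S"
    proof -
      have "card (insert (k - 7) S) = Suc (card S)" using fin that by simp
      moreover have "insert (k - 7) S \<subseteq> {..<7}" using S(1) k by auto
      ultimately show ?thesis using x S by (auto simp: has_parity_def)
    qed
    then show ?thesis using False by (simp add: gen_def annihilate_def)
  qed
qed

lemma has_parity_clifford:
  assumes "x \<in> spinors" "has_parity p x"
  shows "has_parity (\<not> p) (clifford u x)"
  using has_parity_gen[OF assms(2)] by (auto simp: has_parity_def clifford_eq[OF assms(1)] intro!: sum.neutral)

lemma half_spin_clifford: "x \<in> half_spin \<Longrightarrow> clifford u (clifford v x) \<in> half_spin"
  using has_parity_clifford[of x True v] has_parity_clifford[of "clifford v x" False u]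
  by (simp add: half_spin_iff clifford_spinors)

end

section \<open>Computations at the base point\<close>

text \<open>A basis spinor \<open>e\<^sub>S\<close> is labelled by the list of the seven truth values of \<open>i \<in> S\<close>, which
  turns the Clifford action into a list program for \<open>code_simp\<close>.\<close>

definition bset :: "bool list \<Rightarrow> nat set" where
  "bset xs = {i. i < length xs \<and> xs ! i}"

definition ket :: "nat set \<Rightarrow> nat set \<Rightarrow> complex" where
  "ket T S = (if S = T then 1 else 0)"

definition bsg :: "nat \<Rightarrow> bool list \<Rightarrow> int" where
  "bsg i xs = (if even (length (filter id (take i xs))) then 1 else -1)"

text \<open>A generator sends a basis spinor to zero or to a multiple of one basis spinor, so the
  result has at most one term. The sign looks only below the changed position.\<close>

definition act :: "nat \<Rightarrow> bool list \<Rightarrow> (int \<times> bool list) list" where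
  "act k xs = (if k < 7 then (if xs ! k then [] else [(bsg k xs, xs[k := True])])
    else (if xs ! (k - 7) then [(2 * bsg (k - 7) xs, xs[k - 7 := False])] else []))"

definition act_list :: "nat \<Rightarrow> (int \<times> bool list) list \<Rightarrow> (int \<times> bool list) list" where
  "act_list k vs = concat (map (\<lambda>(c, xs). map (\<lambda>(d, ys). (c * d, ys)) (act k xs)) vs)"

definition spinor_of :: "(int \<times> bool list) list \<Rightarrow> nat set \<Rightarrow> complex" where
  "spinor_of vs S = (\<Sum>(c, xs)\<leftarrow>vs. of_int c * ket (bset xs) S)"

definition base_labels :: "bool list list" where
  "base_labels =
  [[False, False, False, False, False, False, False],
     [True, True, True, False, False, False, True],
     [False, False, False, True, True, True, True],
     [True, True, True, True, True, True, False]]"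

definition base_list :: "(int \<times> bool list) list" where
  "base_list = map (Pair 1) base_labels"

definition base_spinor :: "nat set \<Rightarrow> complex" where
  "base_spinor = spinor_of base_list"

text \<open>The four signs are those of \<open>pair_sign\<close> on the base labels, whose index
  sums are 0, 9, 18 and 15.\<close>

definition base_pairing :: "bool list \<Rightarrow> int" where
  "base_pairing xs = (\<Sum>(ys, c)\<leftarrow>zip base_labels [1, -1, 1, -1]. if map Not xs = ys then c else 0)"

definition base_tri :: "nat \<Rightarrow> nat \<Rightarrow> nat \<Rightarrow> int" where
  "base_tri i j k = (\<Sum>(c, xs)\<leftarrow>act_list i (act_list j (act_list k base_list)). c * base_pairing xs)"

text \<open>The nonzero values \<open>v\<close> of \<open>base_tri i a b\<close>, as the list of all \<open>(a, b, v)\<close> at position \<open>i\<close>.\<close>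

definition base_tri_table :: "(nat \<times> nat \<times> int) list list" where
  "base_tri_table =
  [[(1, 2, 2), (2, 1, -2), (6, 7, -2), (7, 6, 2), (7, 13, -4), (13, 7, 4)],
     [(0, 2, -2), (2, 0, 2), (6, 8, -2), (8, 6, 2), (8, 13, -4), (13, 8, 4)],
     [(0, 1, 2), (1, 0, -2), (6, 9, -2), (9, 6, 2), (9, 13, -4), (13, 9, 4)],
     [(4, 5, -2), (5, 4, 2), (6, 10, -2), (10, 6, 2), (10, 13, 4), (13, 10, -4)],
     [(3, 5, 2), (5, 3, -2), (6, 11, -2), (11, 6, 2), (11, 13, 4), (13, 11, -4)],
     [(3, 4, -2), (4, 3, 2), (6, 12, -2), (12, 6, 2), (12, 13, 4), (13, 12, -4)],
     [(0, 7, 2), (1, 8, 2), (2, 9, 2), (3, 10, 2), (4, 11, 2), (5, 12, 2), (7, 0, -2), (8, 1, -2), (9, 2, -2), (10, 3, -2), (11, 4, -2), (12, 5, -2)],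
     [(0, 6, -2), (0, 13, 4), (6, 0, 2), (8, 9, 16), (9, 8, -16), (13, 0, -4)],
     [(1, 6, -2), (1, 13, 4), (6, 1, 2), (7, 9, -16), (9, 7, 16), (13, 1, -4)],
     [(2, 6, -2), (2, 13, 4), (6, 2, 2), (7, 8, 16), (8, 7, -16), (13, 2, -4)],
     [(3, 6, -2), (3, 13, -4), (6, 3, 2), (11, 12, 16), (12, 11, -16), (13, 3, 4)],
     [(4, 6, -2), (4, 13, -4), (6, 4, 2), (10, 12, -16), (12, 10, 16), (13, 4, 4)],
     [(5, 6, -2), (5, 13, -4), (6, 5, 2), (10, 11, 16), (11, 10, -16), (13, 5, 4)],
     [(0, 7, -4), (1, 8, -4), (2, 9, -4), (3, 10, 4), (4, 11, 4), (5, 12, 4), (7, 0, 4), (8, 1, 4), (9, 2, 4), (10, 3, -4), (11, 4, -4), (12, 5, -4)]]"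

text \<open>A sum over all matching entries instead of a search for one, so that it is additive in
  the table and \<open>sum_look\<close> is a plain induction.\<close>

definition look :: "(nat \<times> nat \<times> int) list \<Rightarrow> nat \<Rightarrow> nat \<Rightarrow> int" where
  "look R a b = (\<Sum>(a', b', v)\<leftarrow>R. if a' = a \<and> b' = b then v else 0)"

text \<open>All 14^3 values are evaluated once. Later contractions then run over the at most twelve
  nonzero entries of a row.\<close>

lemma base_tri_table:
  "list_all (\<lambda>i. list_all (\<lambda>a. list_all (\<lambda>b.
     base_tri i a b = look (base_tri_table ! i) a b) [0..<14]) [0..<14]) [0..<14]"
  by code_simp

lemma base_tri_table_bounds:
  "list_all (list_all (\<lambda>(a, b, v). a < 14 \<and> b < 14)) base_tri_table" "length base_tri_table = 14"
  by code_simp+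

text \<open>Up to the factor 2 this is the endomorphism at the base point: it is 48 on e_0, e_1,
  e_2, f_0, f_1, f_2, it is -48 on e_3, e_4, e_5, f_3, f_4, f_5, and it sends e_6 to -24 f_6 and f_6
  to -96 e_6.\<close>

definition base_quart :: "nat \<Rightarrow> nat \<Rightarrow> int" where
  "base_quart i m = (if m = dual_index i then
      (if i = 6 \<or> i = 13 then 0 else if i < 3 \<or> 7 \<le> i \<and> i < 10 then 96 else -96)
    else if m = i then (if i = 6 then -48 else if i = 13 then -192 else 0) else 0)"

lemma base_quart:
  "list_all (\<lambda>i. list_all (\<lambda>m.
     (\<Sum>(a, b, v)\<leftarrow>base_tri_table ! m. v * look (base_tri_table ! i) (dual_index a) (dual_index b))
       = base_quart i m) [0..<14]) [0..<14]"
  by code_simp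

text \<open>9216 = 96^2 = 48 * 192 is four times 2304, because \<open>quart\<close> is twice the
  form of the endomorphism.\<close>

lemma base_quart_square:
  "list_all (\<lambda>u. list_all (\<lambda>v.
     (\<Sum>i\<leftarrow>[0..<14]. base_quart (dual_index i) u * base_quart i v)
       = (if v = dual_index u then 9216 else 0)) [0..<14]) [0..<14]"
  by code_simp

text \<open>Root vectors that map \<open>z\<^sub>0\<close> to a multiple of a single basis spinor, one for each of the sixty
  basis spinors not occurring in \<open>z\<^sub>0\<close>.\<close>

definition tangent_pairs :: "(nat \<times> nat) list" where
  "tangent_pairs =
    [(0, 3), (0, 4), (0, 5), (0, 6), (0, 10), (0, 11), (0, 12), (0, 13), (1, 3), (1, 4), (1,
     5), (1, 6), (1, 10), (1, 11), (1, 12), (1, 13), (2, 3), (2, 4), (2, 5), (2, 6), (2, 10),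
     (2, 11), (2, 12), (2, 13), (3, 6), (3, 7), (3, 8), (3, 9), (3, 13), (4, 6), (4, 7), (4,
     8), (4, 9), (4, 13), (5, 6), (5, 7), (5, 8), (5, 9), (5, 13), (6, 7), (6, 8), (6, 9), (6,
     10), (6, 11), (6, 12), (7, 10), (7, 11), (7, 12), (7, 13), (8, 10), (8, 11), (8, 12), (8,
     13), (9, 10), (9, 11), (9, 12), (9, 13), (10, 13), (11, 13), (12, 13)]"

definition tangent_labels :: "bool list list" where
  "tangent_labels = map (\<lambda>(i, j). snd (hd (act_list i (act_list j base_list)))) tangent_pairs"

lemma tangent_pairs:
  "list_all (\<lambda>(i, j). i < 14 \<and> j < 14 \<and> i \<noteq> j \<and>
     (case act_list i (act_list j base_list) of [(c, xs)] \<Rightarrow> c \<noteq> 0 | _ \<Rightarrow> False)) tangent_pairs"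
  by code_simp

lemma tangent_labels:
  "list_all (\<lambda>xs. odd (length (filter id xs)) \<or> xs \<in> set base_labels \<or> xs \<in> set tangent_labels)
     (List.n_lists 7 [False, True])"
  by code_simp

section \<open>Correctness of the list model\<close>

lemma bset_subset: "length xs = 7 \<Longrightarrow> bset xs \<subseteq> {..<7}"
  by (auto simp: bset_def)

lemma bset_update_True: "i < length xs \<Longrightarrow> bset (xs[i := True]) = insert i (bset xs)"
  by (auto simp: bset_def nth_list_update)

lemma bset_update_False: "i < length xs \<Longrightarrow> bset (xs[i := False]) = bset xs - {i}"
  by (auto simp: bset_def nth_list_update)

lemma bset_not: "length xs = 7 \<Longrightarrow> bset (map Not xs) = {..<7} - bset xs"
  by (auto simp: bset_def)

lemma bset_eq_iff: "length xs = length ys \<Longrightarrow> bset xs = bset ys \<longleftrightarrow> xs = ys"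
  by (auto simp: bset_def list_eq_iff_nth_eq set_eq_iff)

lemma card_bset: "card (bset xs) = length (filter id xs)"
  by (simp add: bset_def length_filter_conv_card)

lemma sg_bset:
  assumes "i \<le> length xs"
  shows "sg i (bset xs) = of_int (bsg i xs)"
proof -
  have "{j \<in> bset xs. j < i} = bset (take i xs)" by (auto simp: bset_def)
  then show ?thesis by (simp add: sg_def card_bset bsg_def minus_one_power_iff)
qed

lemma act_length: "length xs = 7 \<Longrightarrow> (c, ys) \<in> set (act k xs) \<Longrightarrow> length ys = 7"
  by (auto simp: act_def split: if_splits)

lemma gen_ket:
  assumes xs: "length xs = 7" and k: "k < 14"
  shows "gen k (ket (bset xs)) S = (\<Sum>(c, ys)\<leftarrow>act k xs. of_int c * ket (bset ys) S)"
proof (cases "k < 7")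
  case True
  have mem: "k \<in> bset xs \<longleftrightarrow> xs ! k" using True xs by (simp add: bset_def)
  have "create k (ket (bset xs)) S = (if k \<in> bset xs then 0 else sg k (bset xs) * ket (insert k (bset xs)) S)"
  proof (cases "k \<in> S")
    case kS: True
    then have "S - {k} = bset xs \<longleftrightarrow> k \<notin> bset xs \<and> S = insert k (bset xs)" by auto
    then show ?thesis using kS by (auto simp: create_def ket_def sg_insert)
  qed (auto simp: create_def ket_def)
  then show ?thesis using True xs
    by (simp add: gen_def act_def mem bset_update_True sg_bset)
next
  case False
  let ?k = "k - 7"
  have lt: "?k < 7" using k by simp
  have mem: "?k \<in> bset xs \<longleftrightarrow> xs ! ?k" using lt xs by (simp add: bset_def)
  have "annihilate ?k (ket (bset xs)) S
      = (if ?k \<in> bset xs then sg ?k (bset xs) * ket (bset xs - {?k}) S else 0)"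
  proof (cases "?k \<in> S")
    case kS: False
    then have "insert ?k S = bset xs \<longleftrightarrow> ?k \<in> bset xs \<and> S = bset xs - {?k}" by auto
    then show ?thesis using kS by (auto simp: annihilate_def ket_def sg_remove)
  qed (auto simp: annihilate_def ket_def)
  then show ?thesis using False lt xs
    by (simp add: gen_def act_def mem bset_update_False sg_bset)
qed

lemma act_list_length:
  "(\<And>c xs. (c, xs) \<in> set vs \<Longrightarrow> length xs = 7) \<Longrightarrow> (c, ys) \<in> set (act_list k vs) \<Longrightarrow> length ys = 7"
  by (auto simp: act_list_def dest: act_length)

lemma gen_zero: "gen k (\<lambda>S. 0) = (\<lambda>S. 0)"
  by (intro ext) (simp add: gen_def create_def annihilate_def)

lemma gen_spinor_of:
  assumes "\<And>c xs. (c, xs) \<in> set vs \<Longrightarrow> length xs = 7" "k < 14"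
  shows "gen k (spinor_of vs) = spinor_of (act_list k vs)"
  using assms(1)
proof (induction vs)
  case Nil
  then show ?case by (simp add: spinor_of_def[abs_def] act_list_def gen_zero)
next
  case (Cons v vs)
  obtain c xs where v: "v = (c, xs)" by (cases v)
  have xs: "length xs = 7" using Cons.prems v by auto
  have IH: "gen k (spinor_of vs) = spinor_of (act_list k vs)"
  proof (rule Cons.IH)
    fix c xs assume "(c, xs) \<in> set vs"
    then show "length xs = 7" by (intro Cons.prems[of c]) simp
  qed
  show ?case
  proof
    fix S
    have "gen k (spinor_of (v # vs)) S = gen k (\<lambda>S. spinor_of vs S + of_int c * ket (bset xs) S) S"
      by (simp add: spinor_of_def[abs_def] v add.commute)
    also have "\<dots> = spinor_of (act_list k vs) S + of_int c * gen k (ket (bset xs)) S"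
      by (simp add: gen_add IH)
    also have "\<dots> = spinor_of (act_list k (v # vs)) S"
      by (simp add: gen_ket[OF xs assms(2)] spinor_of_def act_list_def v sum_list_const_mult[symmetric]
          split_def comp_def mult.assoc)
    finally show "gen k (spinor_of (v # vs)) S = spinor_of (act_list k (v # vs)) S" .
  qed
qed

lemma base_list_length: "(c, xs) \<in> set base_list \<Longrightarrow> length xs = 7"
  by (auto simp: base_list_def base_labels_def)

lemma pairing_ket:
  assumes "length xs = 7"
  shows "spin_pairing y (ket (bset xs)) = pair_sign (bset (map Not xs)) * y (bset (map Not xs))"
proof -
  have "spin_pairing y (ket (bset xs))
      = (\<Sum>A\<in>Pow {..<7}. if A = bset (map Not xs) then pair_sign A * y A else 0)"
    unfolding spin_pairing_eq
  proof (rule sum.cong)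
    fix A :: "nat set" assume "A \<in> Pow {..<7}"
    then have "{..<7} - A = bset xs \<longleftrightarrow> A = bset (map Not xs)"
      using bset_subset[OF assms] unfolding bset_not[OF assms] by auto
    then show "pair_sign A * y A * ket (bset xs) ({..<7} - A)
        = (if A = bset (map Not xs) then pair_sign A * y A else 0)"
      by (simp add: ket_def)
  qed simp
  moreover have "bset (map Not xs) \<in> Pow {..<7}" using bset_subset[of "map Not xs"] assms by simp
  ultimately show ?thesis by simp
qed

text \<open>Brings the index sums that determine \<open>pair_sign\<close> into a form that
  \<open>code_simp\<close> can evaluate.\<close>

lemma sum_bset: "\<Sum>(bset xs) = sum_list (filter (\<lambda>i. xs ! i) [0..<length xs])"
proof -
  have "bset xs = set (filter (\<lambda>i. xs ! i) [0..<length xs])" by (auto simp: bset_def)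
  then show ?thesis using sum.distinct_set_conv_list[of "filter (\<lambda>i. xs ! i) [0..<length xs]" "\<lambda>i. i"]
    by simp
qed

lemma pair_sign_base_labels:
  "map (\<lambda>ys. pair_sign (bset ys)) base_labels = [1, -1, 1, -1]"
proof -
  have "map (\<lambda>ys. \<Sum>(bset ys)) base_labels = [0, 9, 18, 15]"
    unfolding sum_bset by code_simp
  moreover have "\<forall>ys\<in>set base_labels. pair_sign (bset ys) = (-1) ^ \<Sum>(bset ys)"
    by (auto simp: base_labels_def intro!: pair_sign_eq bset_subset)
  ultimately show ?thesis by (simp add: base_labels_def)
qed

lemma base_pairing:
  assumes "length xs = 7"
  shows "spin_pairing base_spinor (ket (bset xs)) = of_int (base_pairing xs)"
proof -
  have k: "ket (bset ys) (bset (map Not xs)) = (if map Not xs = ys then 1 else 0)"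
    if "ys \<in> set base_labels" for ys
    using that assms bset_eq_iff[of "map Not xs" ys] by (auto simp: ket_def base_labels_def)
  have "pair_sign (bset (map Not xs)) * base_spinor (bset (map Not xs))
      = (\<Sum>ys\<leftarrow>base_labels. pair_sign (bset (map Not xs)) * ket (bset ys) (bset (map Not xs)))"
    by (simp add: base_spinor_def spinor_of_def base_list_def comp_def sum_list_const_mult)
  also have "\<dots> = (\<Sum>ys\<leftarrow>base_labels. if map Not xs = ys then pair_sign (bset ys) else 0)"
    by (intro arg_cong[of _ _ sum_list] map_cong refl) (simp add: k)
  also have "\<dots> = of_int (base_pairing xs)"
    using pair_sign_base_labels by (simp add: base_pairing_def base_labels_def)
  finally show ?thesis unfolding pairing_ket[OF assms] .
qed

lemma pairing_spinor_of:
  assumes "\<And>c xs. (c, xs) \<in> set vs \<Longrightarrow> length xs = 7"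
  shows "spin_pairing base_spinor (spinor_of vs) = of_int (\<Sum>(c, xs)\<leftarrow>vs. c * base_pairing xs)"
  using assms
proof (induction vs)
  case Nil
  then show ?case by (simp add: spinor_of_def[abs_def] spin_pairing_eq)
next
  case (Cons v vs)
  obtain c xs where v: "v = (c, xs)" by (cases v)
  have IH: "spin_pairing base_spinor (spinor_of vs) = of_int (\<Sum>(c, xs)\<leftarrow>vs. c * base_pairing xs)"
  proof (rule Cons.IH)
    fix c xs assume "(c, xs) \<in> set vs"
    then show "length xs = 7" by (intro Cons.prems[of c]) simp
  qed
  have "spin_pairing base_spinor (spinor_of (v # vs))
      = spin_pairing base_spinor (\<lambda>S. spinor_of vs S + of_int c * ket (bset xs) S)"
    by (simp add: spinor_of_def[abs_def] v add.commute)
  also have "\<dots> = spin_pairing base_spinor (spinor_of vs) + of_int c * of_int (base_pairing xs)"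
    unfolding pairing_add_right using base_pairing[of xs] Cons.prems v by auto
  also have "\<dots> = of_int (\<Sum>(c, xs)\<leftarrow>v # vs. c * base_pairing xs)"
    by (simp add: v IH)
  finally show ?case .
qed

lemma sum_look:
  fixes h :: "nat \<Rightarrow> nat \<Rightarrow> int"
  assumes "list_all (\<lambda>(a, b, v). a < 14 \<and> b < 14) R"
  shows "(\<Sum>a<14. \<Sum>b<14. look R a b * h a b) = (\<Sum>(a, b, v)\<leftarrow>R. v * h a b)"
  using assms
proof (induction R)
  case (Cons r R)
  obtain a' b' v where r: "r = (a', b', v)" by (cases r)
  have "(\<Sum>b<14. (if a' = a \<and> b' = b then v else 0) * h a b) = (if a = a' then v * h a' b' else 0)" for a
  proof -
    have "(\<Sum>b<14. (if a' = a \<and> b' = b then v else 0) * h a b)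
      = (\<Sum>b<14. if b = b' then (if a = a' then v * h a' b' else 0) else 0)"
      by (rule sum.cong) auto
    then show ?thesis using Cons.prems r by simp
  qed
  then have "(\<Sum>a<14. \<Sum>b<14. (if a' = a \<and> b' = b then v else 0) * h a b) = v * h a' b'"
    using Cons.prems r by simp
  then show ?case using Cons by (simp add: look_def r distrib_right sum.distrib)
qed (simp add: look_def)

lemma base_spinor_half_spin: "base_spinor \<in> half_spin"
proof -
  have "even (card (bset xs))" "bset xs \<subseteq> {..<7}" if "xs \<in> set base_labels" for xs
    using that bset_subset[of xs] by (auto simp: base_labels_def card_bset)
  then have "(\<Sum>xs\<leftarrow>base_labels. ket (bset xs) S) = (\<Sum>xs\<leftarrow>base_labels. 0)" if "S \<notin> spin_coords" for S
    using that by (intro arg_cong[of _ _ sum_list] map_cong refl) (auto simp: ket_def spin_coords_def)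
  then show ?thesis
    by (simp add: half_spin_def base_spinor_def spinor_of_def base_list_def comp_def)
qed

section \<open>Linear algebra of \<open>line_span\<close>\<close>

lemma half_spin_eq_sum_ket:
  assumes "x \<in> half_spin"
  shows "x = (\<lambda>S. \<Sum>T\<in>spin_coords. x T * ket T S)"
proof
  fix S
  have "(\<Sum>T\<in>spin_coords. x T * ket T S) = (\<Sum>T\<in>spin_coords. if T = S then x T else 0)"
    by (rule sum.cong) (auto simp: ket_def)
  also have "\<dots> = x S" using assms by (simp add: finite_spin_coords half_spin_def)
  finally show "x S = (\<Sum>T\<in>spin_coords. x T * ket T S)" ..
qed

text \<open>The rule \<open>comb\<close> fixes the first coefficient to be 1; combining
  \<open>v\<close> with itself gives every multiple.\<close>

lemma line_span_scale:
  assumes "v \<in> line_span X z"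
  shows "(\<lambda>S. c * v S) \<in> line_span X z"
proof -
  have "(\<lambda>S. v S + (c - 1) * v S) \<in> line_span X z" by (rule line_span.comb[OF assms assms])
  then show ?thesis by (simp add: algebra_simps)
qed

lemma line_span_add:
  "v \<in> line_span X z \<Longrightarrow> w \<in> line_span X z \<Longrightarrow> (\<lambda>S. v S + w S) \<in> line_span X z"
  using line_span.comb[of v X z w 1] by simp

text \<open>The index set is nonempty because \<open>line_span\<close> has no separate rule for the
  zero vector.\<close>

lemma line_span_sum:
  assumes "finite I" "I \<noteq> {}" "\<And>i. i \<in> I \<Longrightarrow> v i \<in> line_span X z"
  shows "(\<lambda>S. \<Sum>i\<in>I. c i * v i S) \<in> line_span X z"
  using assms
proof (induction I rule: finite_ne_induct)
  case (singleton i)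
  then show ?case by (simp add: line_span_scale)
next
  case (insert i I)
  then show ?case by (simp add: line_span_add line_span_scale)
qed

text \<open>(2a + 2b) + (2a + 2c) - (2b + 2c) = 4a.\<close>

lemma line_span_triangle:
  assumes "(\<lambda>S. 2 * a S + 2 * b S) \<in> line_span X z" "(\<lambda>S. 2 * b S + 2 * c S) \<in> line_span X z"
    "(\<lambda>S. 2 * a S + 2 * c S) \<in> line_span X z"
  shows "a \<in> line_span X z"
proof -
  from line_span_scale[OF line_span.comb[OF line_span_add[OF assms(1,3)] assms(2), of "-1"], of "1/4"]
  show ?thesis by (simp add: algebra_simps)
qed

lemma half_spin_subset_line_span:
  assumes "\<And>T. T \<in> spin_coords \<Longrightarrow> ket T \<in> line_span X z"
  shows "half_spin \<subseteq> line_span X z"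
proof
  fix x assume "x \<in> half_spin"
  moreover have "{} \<in> spin_coords" by (simp add: spin_coords_def)
  then have "(\<lambda>S. \<Sum>T\<in>spin_coords. x T * ket T S) \<in> line_span X z"
    by (intro line_span_sum finite_spin_coords assms) auto
  ultimately show "x \<in> line_span X z" using half_spin_eq_sum_ket by metis
qed

text \<open>A linear map that preserves \<open>X\<close> carries lines inside \<open>X\<close> to
  lines inside \<open>X\<close>.\<close>

lemma line_span_image:
  assumes "d \<in> line_span X z" "z \<in> half_spin"
    and lin: "\<And>x y k. x \<in> half_spin \<Longrightarrow> y \<in> half_spin \<Longrightarrow>
      T (\<lambda>S. x S + k * y S) = (\<lambda>S. T x S + k * T y S)"
    and X: "\<And>x. x \<in> X \<Longrightarrow> T x \<in> X" and half: "\<And>x. x \<in> half_spin \<Longrightarrow> T x \<in> half_spin"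
  shows "T d \<in> line_span X (T z)"
  using assms(1)
proof induction
  case (line d)
  have "(\<lambda>S. T z S + s * T d S) \<in> X" if "s \<noteq> -1" for s
    using X[OF line(2)[OF that]] lin[OF assms(2) line(1)] by simp
  then show ?case using half[OF line(1)] by (rule line_span.line[rotated])
next
  case (comb v w k)
  then have "v \<in> half_spin" "w \<in> half_spin" using line_span_subset by blast+
  then show ?case using line_span.comb[OF comb.IH, of k] by (simp only: lin)
qed

context split_quadratic_space_14
begin

section \<open>Values of the forms at the base point\<close>

lemma tri_base:
  assumes "i < 14" "j < 14" "k < 14"
  shows "tri base_spinor (basis_vec i) (basis_vec j) (basis_vec k) = of_int (base_tri i j k)"
proof -
  have sp: "base_spinor \<in> spinors" using base_spinor_half_spin half_spin_subset_spinors by blast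
  have l: "\<And>c xs. (c, xs) \<in> set (act_list k base_list) \<Longrightarrow> length xs = 7"
    by (rule act_list_length[OF base_list_length])
  have l': "\<And>c xs. (c, xs) \<in> set (act_list j (act_list k base_list)) \<Longrightarrow> length xs = 7"
    by (rule act_list_length[OF l])
  have l'': "\<And>c xs. (c, xs) \<in> set (act_list i (act_list j (act_list k base_list))) \<Longrightarrow> length xs = 7"
    by (rule act_list_length[OF l'])
  have "clifford (basis_vec i) (clifford (basis_vec j) (clifford (basis_vec k) base_spinor))
      = gen i (gen j (gen k base_spinor))"
    using assms by (simp add: clifford_basis gen_spinors sp)
  also have "\<dots> = spinor_of (act_list i (act_list j (act_list k base_list)))"
    unfolding base_spinor_def
    by (simp only: gen_spinor_of[OF base_list_length assms(3)] gen_spinor_of[OF l assms(2)]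
        gen_spinor_of[OF l' assms(1)])
  finally show ?thesis
    unfolding tri_def base_tri_def using pairing_spinor_of[OF l''] by simp
qed

lemma tri_base_look:
  assumes "i < 14" "a < 14" "b < 14"
  shows "tri base_spinor (basis_vec i) (basis_vec a) (basis_vec b) = of_int (look (base_tri_table ! i) a b)"
  using base_tri_table assms unfolding list_all_iff by (simp add: tri_base[OF assms])

lemma quart_base:
  assumes "i < 14" "m < 14"
  shows "quart base_spinor (basis_vec i) (basis_vec m) = of_int (base_quart i m)"
proof -
  have R: "list_all (\<lambda>(a, b, v). a < 14 \<and> b < 14) (base_tri_table ! m)"
    using base_tri_table_bounds assms(2) by (simp add: list_all_length)
  have "quart base_spinor (basis_vec i) (basis_vec m) = (\<Sum>a<14. \<Sum>b<14. of_int
      (look (base_tri_table ! m) a b * look (base_tri_table ! i) (dual_index a) (dual_index b)))"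
    unfolding quart_def
    by (intro sum.cong refl) (simp add: dual_vec_eq tri_base_look assms)
  also have "\<dots> = of_int (\<Sum>a<14. \<Sum>b<14.
      look (base_tri_table ! m) a b * look (base_tri_table ! i) (dual_index a) (dual_index b))"
    by simp
  also have "\<dots> = of_int (base_quart i m)"
    using base_quart assms unfolding sum_look[OF R] list_all_iff by simp
  finally show ?thesis .
qed

lemma norm_form_base:
  assumes "u < 14" "v < 14"
  shows "norm_form base_spinor (basis_vec u) (basis_vec v) = 2304 * q (basis_vec u) (basis_vec v)"
proof -
  have sp: "base_spinor \<in> spinors" using base_spinor_half_spin half_spin_subset_spinors by blast
  have "norm_form base_spinor (basis_vec u) (basis_vec v)
      = 1/4 * (\<Sum>i<14. of_int (base_quart (dual_index i) u * base_quart i v))"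
    by (simp add: norm_form_eq[OF sp] dual_vec_eq quart_base assms)
  also have "(\<Sum>i<14. of_int (base_quart (dual_index i) u * base_quart i v))
      = of_int (\<Sum>i\<leftarrow>[0..<14]. base_quart (dual_index i) u * base_quart i v)"
    by (simp only: of_int_sum[symmetric] sum_list_distinct_conv_sum_set distinct_upt
        set_upt lessThan_atLeast0)
  also have "(\<Sum>i\<leftarrow>[0..<14]. base_quart (dual_index i) u * base_quart i v)
      = (if v = dual_index u then 9216 else 0)"
    using base_quart_square assms unfolding list_all_iff by simp
  finally have "norm_form base_spinor (basis_vec u) (basis_vec v)
      = 1/4 * of_int (if v = dual_index u then 9216 else 0)" .
  then show ?thesis by (simp only: q_basis[OF assms]) simp
qed

lemma octic_base: "octic base_spinor = 2304"
  by (simp add: octic_def dual_vec_eq norm_form_base q_basis)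

lemma defect_base: "defect u v base_spinor = 0"
proof -
  have sp: "base_spinor \<in> spinors" using base_spinor_half_spin half_spin_subset_spinors by blast
  have "norm_form base_spinor (basis_vec k) v = 2304 * q (basis_vec k) v" if "k < 14" for k v
  proof -
    have "norm_form base_spinor (basis_vec k) v
        = (\<Sum>l<14. q v (dual_vec l) * norm_form base_spinor (basis_vec k) (basis_vec l))"
      by (simp add: linear_form_expand(1)[OF linear_form_norm_form2[OF sp]])
    also have "\<dots> = 2304 * (\<Sum>l<14. q v (dual_vec l) * q (basis_vec k) (basis_vec l))"
      unfolding sum_distrib_left using that by (intro sum.cong refl) (simp add: norm_form_base)
    finally show ?thesis by (simp add: linear_form_expand(1)[OF linear_form_q])
  qed
  then have "norm_form base_spinor u v = (\<Sum>k<14. q u (dual_vec k) * (2304 * q v (basis_vec k)))"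
    using linear_form_expand(1)[OF linear_form_norm_form1[OF sp], of u v] by (simp add: q_sym[of v])
  also have "\<dots> = 2304 * (\<Sum>k<14. q u (dual_vec k) * q v (basis_vec k))"
    by (simp add: sum_distrib_left mult.left_commute)
  also have "\<dots> = 2304 * q v u"
    by (simp only: linear_form_expand(1)[OF linear_form_q])
  finally show ?thesis by (simp add: defect_def octic_base q_sym)
qed

section \<open>The orbit of the base point\<close>

text \<open>Scalars are indispensable: \<open>octic\<close> is constant along Spin orbits, so the
  Spin orbit alone lies in a level hypersurface.\<close>

inductive_set orbit :: "(nat set \<Rightarrow> complex) set" where
  orbit_base: "base_spinor \<in> orbit"
| orbit_scale: "z \<in> orbit \<Longrightarrow> c \<noteq> 0 \<Longrightarrow> (\<lambda>S. c * z S) \<in> orbit"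
| orbit_clifford: "z \<in> orbit \<Longrightarrow> q u u = 1 \<Longrightarrow> q v v = 1 \<Longrightarrow> clifford u (clifford v z) \<in> orbit"

lemma orbit_subset: "orbit \<subseteq> half_spin"
proof
  fix z assume "z \<in> orbit"
  then show "z \<in> half_spin"
    by induction (auto intro: base_spinor_half_spin half_spin_scale half_spin_clifford)
qed

lemma orbit_spinors: "z \<in> orbit \<Longrightarrow> z \<in> spinors"
  using orbit_subset half_spin_subset_spinors by blast

lemma clifford_comb2:
  assumes "z \<in> spinors"
  shows "clifford (a *s u + b *s v) z = (\<lambda>S. a * clifford u z S + b * clifford v z S)"
proof
  fix S
  note lin = linear_form_clifford[OF assms, of S]
  show "clifford (a *s u + b *s v) z S = a * clifford u z S + b * clifford v z S"
    using linear_form_comb[OF lin, of "a *s u" b v] linear_form_comb[OF lin, of 0 a u]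
      linear_form_zero[OF lin] by simp
qed

lemma line_span_self:
  assumes "z \<in> orbit"
  shows "z \<in> line_span orbit z"
proof (rule line_span.line)
  show "z \<in> half_spin" using assms orbit_subset by blast
  fix s :: complex assume "s \<noteq> -1"
  then have "1 + s \<noteq> 0" by (simp add: add_eq_0_iff)
  from orbit_scale[OF assms this] show "(\<lambda>S. z S + s * z S) \<in> orbit" by (simp add: algebra_simps)
qed

text \<open>Products of a unit vector and an isotropic vector orthogonal to it are nilpotent, so
  \<open>1 + s r y = r (r + s y)\<close> lies in the spin group.\<close>

lemma line_span_unipotent:
  assumes z: "z \<in> orbit" and r: "q r r = 1" and y: "q y y = 0" "q r y = 0"
  shows "clifford r (clifford y z) \<in> line_span orbit z"
proof (rule line_span.line)
  note sp = orbit_spinors[OF z]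
  show "clifford r (clifford y z) \<in> half_spin" using z orbit_subset half_spin_clifford by blast
  fix s :: complex
  have "q (r + s *s y) (r + s *s y) = 1"
    using r y q_sym[of y r] by (simp add: q_add q_add_right q_scale q_scale_right)
  from orbit_clifford[OF z r this] have "clifford r (clifford (r + s *s y) z) \<in> orbit" .
  also have "clifford r (clifford (r + s *s y) z) = (\<lambda>S. z S + s * clifford r (clifford y z) S)"
    by (intro ext) (simp add: clifford_comb_fun[OF sp] clifford_linear clifford_spinors sp clifford_unit[OF r])
  finally show "(\<lambda>S. z S + s * clifford r (clifford y z) S) \<in> orbit" .
qed

text \<open>\<open>basis_vec i\<close> is isotropic, so it is completed by its dual vector to unit
  vectors a e + b f with 2ab = 1, both summands being orthogonal to \<open>basis_vec j\<close>. Two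
  such vectors suffice to eliminate the dual part.\<close>

lemma line_span_root:
  assumes z: "z \<in> orbit" and ij: "i < 14" "j < 14" "j \<noteq> i" "j \<noteq> dual_index i"
  shows "gen i (gen j z) \<in> line_span orbit z"
proof -
  note sp = orbit_spinors[OF z]
  let ?e = "basis_vec i" and ?f = "basis_vec (dual_index i)" and ?y = "basis_vec j"
  let ?E = "gen i (gen j z)" and ?F = "gen (dual_index i) (gen j z)"
  have ne: "dual_index i \<noteq> i" "dual_index j \<noteq> j" by (auto simp: dual_index_def)
  have "(\<lambda>S. a * ?E S + b * ?F S) \<in> line_span orbit z" if "2 * a * b = 1" for a b
  proof -
    have "q (a *s ?e + b *s ?f) (a *s ?e + b *s ?f) = 1"
      using that ij ne by (simp add: q_add q_add_right q_scale q_scale_right q_basis algebra_simps)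
    moreover have "q ?y ?y = 0" "q (a *s ?e + b *s ?f) ?y = 0"
      using ij ne by (simp_all add: q_add q_scale q_basis)
    ultimately have "clifford (a *s ?e + b *s ?f) (clifford ?y z) \<in> line_span orbit z"
      by (rule line_span_unipotent[OF z])
    then show ?thesis
      using ij by (simp add: clifford_comb2 clifford_basis sp gen_spinors)
  qed
  \<comment> \<open>(2, 1/4) - 1/2 (1, 1/2) = (3/2, 0).\<close>
  from line_span.comb[OF this[of 2 "1/4"] this[of 1 "1/2"], of "-1/2"]
  have "(\<lambda>S. 3/2 * ?E S) \<in> line_span orbit z" by (simp add: algebra_simps)
  from line_span_scale[OF this, of "2/3"] show ?thesis by simp
qed

text \<open>For a hyperbolic pair \<open>e, f\<close> the product of the unit vectors \<open>e / \<tau> + (\<tau> / 2) f\<close> and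
  \<open>e + f / 2\<close> acts diagonally.\<close>

lemma line_span_torus:
  assumes z: "z \<in> orbit" and k: "k < 14"
  shows "gen (dual_index k) (gen k z) \<in> line_span orbit z"
proof -
  note sp = orbit_spinors[OF z]
  let ?e = "basis_vec k" and ?f = "basis_vec (dual_index k)"
  let ?E = "gen k (gen (dual_index k) z)" and ?F = "gen (dual_index k) (gen k z)"
  have ne: "dual_index k \<noteq> k" by (auto simp: dual_index_def)
  have nil: "gen k (gen k z) S = 0" "gen (dual_index k) (gen (dual_index k) z) S = 0" for S
    using gen_gen[of k k z S] gen_gen[of "dual_index k" "dual_index k" z S] k ne by auto
  have sum: "?E S = 2 * z S - ?F S" for S
    using gen_gen[of k "dual_index k" z S] k by (simp add: eq_diff_eq)
  have half: "?F \<in> half_spin"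
    using half_spin_clifford[of z ?f ?e] z orbit_subset k
    by (auto simp: clifford_basis sp gen_spinors)
  have "(\<lambda>S. z S + s * (1/2 * ?F S)) \<in> orbit" if s: "s \<noteq> -1" for s
  proof -
    \<comment> \<open>\<open>1/2 * ?E\<close> and \<open>1/2 * ?F\<close> are complementary parts of
      \<open>z\<close>, on which the product of the two unit vectors acts by 1/\<tau> and \<tau>.
      Rescaling by \<tau> gives 1 and \<tau>^2 = 1 + s, which is affine in \<open>s\<close>.\<close>
    define \<tau> where "\<tau> = csqrt (1 + s)"
    have \<tau>: "\<tau> ^ 2 = 1 + s" by (simp add: \<tau>_def)
    then have \<tau>0: "\<tau> \<noteq> 0" using s by (auto simp: add_eq_0_iff)
    let ?u = "(1 / \<tau>) *s ?e + (\<tau> / 2) *s ?f" and ?v = "1 *s ?e + (1/2) *s ?f"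
    have "q ?u ?u = 1" "q ?v ?v = 1"
      using \<tau>0 k ne by (simp_all add: q_add q_add_right q_scale q_scale_right q_basis field_simps)
    then have "(\<lambda>S. \<tau> * clifford ?u (clifford ?v z) S) \<in> orbit"
      by (intro orbit_scale orbit_clifford z \<tau>0)
    also have "(\<lambda>S. \<tau> * clifford ?u (clifford ?v z) S) = (\<lambda>S. z S + s * (1/2 * ?F S))"
    proof
      fix S
      have spe: "gen k z \<in> spinors" "gen (dual_index k) z \<in> spinors"
        using gen_spinors sp k by auto
      define y where "y = (\<lambda>S. gen k z S + 1/2 * gen (dual_index k) z S)"
      have y: "y \<in> spinors" unfolding y_def by (rule spinors_comb[OF spe])
      have "clifford ?v z = y"
        by (simp only: clifford_comb2[OF sp] clifford_basis[OF sp] k dual_index_less mult_1 y_def)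
      moreover have "gen k y S = 1/2 * ?E S" "gen (dual_index k) y S = ?F S"
        unfolding y_def gen_add nil by simp_all
      ultimately have "clifford ?u (clifford ?v z) S = 1 / \<tau> * (1/2 * ?E S) + \<tau> / 2 * ?F S"
        by (simp only: clifford_comb2[OF y] clifford_basis[OF y] k dual_index_less)
      then have "\<tau> * clifford ?u (clifford ?v z) S = 1/2 * ?E S + \<tau> ^ 2 * (1/2 * ?F S)"
        using \<tau>0 by (simp add: field_simps power2_eq_square)
      also have "\<dots> = z S + s * (1/2 * ?F S)"
        unfolding \<tau> sum by (simp add: field_simps)
      finally show "\<tau> * clifford ?u (clifford ?v z) S = z S + s * (1/2 * ?F S)" .
    qed
    finally show ?thesis .
  qed
  then have "(\<lambda>S. 1/2 * ?F S) \<in> line_span orbit z"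
    using half_spin_scale[OF half, of "1/2"] by (intro line_span.line)
  from line_span_scale[OF this, of 2] show ?thesis by simp
qed

text \<open>Dual indices give a Cartan direction, all other pairs of distinct indices a root
  direction.\<close>

lemma root_vector_mem_line_span:
  assumes "i < 14" "j < 14" "i \<noteq> j" "act_list i (act_list j base_list) = vs"
  shows "spinor_of vs \<in> line_span orbit base_spinor"
proof -
  have "gen i (gen j base_spinor) = spinor_of (act_list i (act_list j base_list))"
    unfolding base_spinor_def
    by (simp only: gen_spinor_of[OF base_list_length assms(2)]
      gen_spinor_of[OF act_list_length[OF base_list_length] assms(1)])
  moreover have "gen i (gen j base_spinor) \<in> line_span orbit base_spinor"
    using line_span_root[OF orbit_base assms(1,2)] line_span_torus[OF orbit_base assms(2)] assms
    by (cases "j = dual_index i") auto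
  ultimately show ?thesis using assms(4) by simp
qed

lemma ket_tangent:
  assumes "xs \<in> set tangent_labels"
  shows "ket (bset xs) \<in> line_span orbit base_spinor"
proof -
  obtain i j where ij: "(i, j) \<in> set tangent_pairs" "xs = snd (hd (act_list i (act_list j base_list)))"
    using assms by (auto simp: tangent_labels_def)
  have "i < 14 \<and> j < 14 \<and> i \<noteq> j \<and>
     (case act_list i (act_list j base_list) of [(c, xs)] \<Rightarrow> c \<noteq> 0 | _ \<Rightarrow> False)"
    using tangent_pairs ij(1) unfolding list_all_iff by fast
  then obtain c where c: "i < 14" "j < 14" "i \<noteq> j" "act_list i (act_list j base_list) = [(c, xs)]" "c \<noteq> 0"
    using ij(2) by (auto split: list.splits)
  from line_span_scale[OF root_vector_mem_line_span[OF c(1-4)], of "1 / of_int c"] c(5)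
  show ?thesis by (simp add: spinor_of_def)
qed

text \<open>Creation after annihilation at an index keeps, up to a factor 2, the base terms
  containing that index: indices 0, 3 and 6 give the three pairwise sums of the terms other than the
  vacuum. The vacuum is in none of them and comes from the scaling direction.\<close>

lemma ket_base_label:
  assumes "xs \<in> set base_labels"
  shows "ket (bset xs) \<in> line_span orbit base_spinor"
proof -
  define K where "K n = ket (bset (base_labels ! n))" for n
  let ?L = "line_span orbit base_spinor"
  have z: "base_spinor = (\<lambda>S. K 0 S + K 1 S + K 2 S + K 3 S)"
    by (intro ext) (simp add: base_spinor_def spinor_of_def base_list_def base_labels_def K_def)
  have "act_list 0 (act_list 7 base_list) = [(2, base_labels ! 1), (2, base_labels ! 3)]"
    "act_list 3 (act_list 10 base_list) = [(2, base_labels ! 2), (2, base_labels ! 3)]"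
    "act_list 6 (act_list 13 base_list) = [(2, base_labels ! 1), (2, base_labels ! 2)]"
    by code_simp+
  then have h: "(\<lambda>S. 2 * K 1 S + 2 * K 3 S) \<in> ?L" "(\<lambda>S. 2 * K 2 S + 2 * K 3 S) \<in> ?L"
    "(\<lambda>S. 2 * K 1 S + 2 * K 2 S) \<in> ?L"
    using root_vector_mem_line_span[of 0 7] root_vector_mem_line_span[of 3 10] root_vector_mem_line_span[of 6 13]
    by (simp_all add: spinor_of_def[abs_def] K_def)
  then have h': "(\<lambda>S. 2 * K 3 S + 2 * K 1 S) \<in> ?L" "(\<lambda>S. 2 * K 3 S + 2 * K 2 S) \<in> ?L"
    "(\<lambda>S. 2 * K 2 S + 2 * K 1 S) \<in> ?L"
    by (simp_all only: add.commute)
  have 1: "K 1 \<in> ?L" by (rule line_span_triangle[OF h(1) h'(2) h(3)])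
  have 2: "K 2 \<in> ?L" by (rule line_span_triangle[OF h(2) h'(1) h'(3)])
  have 3: "K 3 \<in> ?L" by (rule line_span_triangle[OF h'(1) h(3) h'(2)])
  have "(\<lambda>S. base_spinor S + (-1) * (K 1 S + K 2 S + K 3 S)) \<in> ?L"
    by (intro line_span.comb line_span_add line_span_self orbit_base 1 2 3)
  then have 0: "K 0 \<in> ?L" unfolding z by (simp add: algebra_simps)
  have "n < 4 \<Longrightarrow> K n \<in> ?L" for n
    using 0 1 2 3 by (auto simp: less_Suc_eq numeral_eq_Suc)
  moreover have "length base_labels = 4" by (simp add: base_labels_def)
  then obtain n where "n < 4" "xs = base_labels ! n"
    using assms by (auto simp: in_set_conv_nth)
  ultimately show ?thesis by (auto simp: K_def)
qed

lemma line_span_base: "half_spin \<subseteq> line_span orbit base_spinor"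
proof (rule half_spin_subset_line_span)
  fix T assume T: "T \<in> spin_coords"
  define xs where "xs = map (\<lambda>i. i \<in> T) [0..<7]"
  have xs: "length xs = 7" "bset xs = T" using T by (auto simp: xs_def bset_def spin_coords_def)
  have "xs \<in> set (List.n_lists 7 [False, True])" using xs by (auto simp: set_n_lists)
  then have "xs \<in> set base_labels \<or> xs \<in> set tangent_labels"
    using tangent_labels T card_bset[of xs] xs(2) unfolding list_all_iff
    by (auto simp: spin_coords_def)
  then show "ket T \<in> line_span orbit base_spinor"
    using ket_base_label ket_tangent xs(2) by blast
qed

lemma clifford2_linear:
  assumes "x \<in> spinors" "y \<in> spinors"
  shows "clifford u (clifford v (\<lambda>S. x S + k * y S))
    = (\<lambda>S. clifford u (clifford v x) S + k * clifford u (clifford v y) S)"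
proof -
  have lin: "clifford w (\<lambda>S. x S + k * y S) = (\<lambda>S. clifford w x S + k * clifford w y S)"
    if "x \<in> spinors" "y \<in> spinors" for w x y
    by (intro ext clifford_linear that)
  show ?thesis by (simp only: lin assms clifford_spinors)
qed

text \<open>Each generator of the orbit acts by an invertible linear map preserving it. A given
  direction is pulled back by the inverse, which for two unit vectors is the product in the opposite
  order, and then pushed forward by \<open>line_span_image\<close>.\<close>

lemma line_span_orbit:
  assumes "z \<in> orbit"
  shows "half_spin \<subseteq> line_span orbit z"
  using assms
proof induction
  case orbit_base
  show ?case by (rule line_span_base)
next
  case (orbit_scale z c)
  show ?case
  proof
    fix x assume "x \<in> half_spin"
    then have "(\<lambda>S. 1 / c * x S) \<in> line_span orbit z"
      using orbit_scale.IH half_spin_scale by blast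
    then have "(\<lambda>S. c * (1 / c * x S)) \<in> line_span orbit (\<lambda>S. c * z S)"
      by (rule line_span_image[where T = "\<lambda>x S. c * x S"])
        (use orbit_scale.hyps orbit_subset in \<open>auto simp: algebra_simps intro: half_spin_scale orbit.orbit_scale\<close>)
    then show "x \<in> line_span orbit (\<lambda>S. c * z S)" using orbit_scale.hyps by simp
  qed
next
  case (orbit_clifford z u v)
  show ?case
  proof
    fix x assume x: "x \<in> half_spin"
    then have sp: "x \<in> spinors" using half_spin_subset_spinors by blast
    have "clifford v (clifford u x) \<in> line_span orbit z"
      using orbit_clifford.IH half_spin_clifford[OF x] by blast
    then have "clifford u (clifford v (clifford v (clifford u x)))
        \<in> line_span orbit (clifford u (clifford v z))"
      by (rule line_span_image[where T = "\<lambda>x. clifford u (clifford v x)"])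
        (use orbit_clifford.hyps orbit_subset half_spin_subset_spinors in
          \<open>auto intro: half_spin_clifford orbit.orbit_clifford clifford2_linear\<close>)
    then show "x \<in> line_span orbit (clifford u (clifford v z))"
      using sp orbit_clifford.hyps by (simp add: clifford_unit clifford_spinors)
  qed
qed

section \<open>Consequences of density: scalar square, uniqueness of the octic,
  factorization\<close>

lemma vanish_on_half_spin:
  assumes "homogeneous_on_half_spin d P" "\<And>z. z \<in> orbit \<Longrightarrow> P z = 0" "z \<in> half_spin"
  shows "P z = 0"
proof (rule bounded_degree_vanishing[where P = P])
  show "half_spin \<subseteq> line_span orbit z" if "z \<in> orbit" for z by (rule line_span_orbit[OF that])
  show "orbit \<noteq> {}" using orbit_base by blast
qed (use assms orbit_subset homogeneous_imp_bounded_degree in auto)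

lemma defect_zero:
  assumes "z \<in> half_spin"
  shows "defect u v z = 0"
proof -
  \<comment> \<open>All \<open>u\<close> and \<open>v\<close> have to be treated together, because
    the induction step replaces them by reflected vectors.\<close>
  have "\<forall>u v. defect u v z = 0" if "z \<in> orbit" for z
    using that
  proof induction
    case (orbit_scale z c)
    then show ?case using homogeneous_scale[OF homogeneous_defect] orbit_subset by fastforce
  next
    case (orbit_clifford z r r')
    then show ?case by (simp add: defect_clifford clifford_spinors orbit_spinors)
  qed (simp add: defect_base)
  then show ?thesis using vanish_on_half_spin[OF homogeneous_defect _ assms] by blast
qed

lemma spin_group_half_spin: "g \<in> spin_group \<Longrightarrow> z \<in> half_spin \<Longrightarrow> g z \<in> half_spin"
  by (induction rule: spin_group.induct) (auto intro: half_spin_clifford)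

lemma invariant_octic_octic: "invariant_octic octic"
proof -
  have "octic (g z) = octic z" if "g \<in> spin_group" "z \<in> half_spin" for g z
    using that(1)
  proof induction
    case (spin_mult g u v)
    have "g z \<in> spinors"
      using spin_group_half_spin[OF spin_mult(1) that(2)] half_spin_subset_spinors by blast
    then show ?case using spin_mult by (simp add: octic_clifford clifford_spinors)
  qed simp
  moreover have "octic base_spinor \<noteq> 0" by (simp add: octic_base)
  ultimately show ?thesis
    using homogeneous_octic base_spinor_half_spin unfolding invariant_octic_def by blast
qed

lemma invariant_octic_unique:
  assumes J: "invariant_octic J"
  shows "\<exists>c. c \<noteq> 0 \<and> (\<forall>z\<in>half_spin. octic z = c * J z)"
proof -
  have hom: "homogeneous_on_half_spin 8 J" using J by (simp add: invariant_octic_def)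
  \<comment> \<open>2304 is the value of \<open>octic\<close> at the base point, so this combination
    of two invariants vanishes there, and by invariance and homogeneity on the whole orbit.\<close>
  let ?P = "\<lambda>z. 2304 * J z + (- J base_spinor) * octic z"
  have homP: "homogeneous_on_half_spin 8 ?P"
    by (intro homogeneous_add homogeneous_cmult hom homogeneous_octic)
  have "?P z = 0" if "z \<in> orbit" for z
    using that
  proof induction
    case (orbit_scale z c)
    then show ?case using homogeneous_scale[OF homP, of z c] orbit_subset by auto
  next
    case (orbit_clifford z u v)
    have "clifford u \<circ> clifford v \<circ> id \<in> spin_group"
      using orbit_clifford by (intro spin_mult spin_id)
    then have "J ((clifford u \<circ> clifford v \<circ> id) z) = J z"
      using J orbit_clifford(1) orbit_subset unfolding invariant_octic_def by blast
    moreover have "octic (clifford u (clifford v z)) = octic z"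
      using orbit_clifford by (simp add: octic_clifford clifford_spinors orbit_spinors)
    ultimately show ?case using orbit_clifford by simp
  qed (simp add: octic_base)
  then have P: "2304 * J z = J base_spinor * octic z" if "z \<in> half_spin" for z
    using vanish_on_half_spin[OF homP _ that] by simp
  \<comment> \<open>Otherwise the proportionality would force \<open>J\<close> to vanish
    identically.\<close>
  have "J base_spinor \<noteq> 0"
  proof
    assume "J base_spinor = 0"
    then have "J z = 0" if "z \<in> half_spin" for z using P[OF that] by simp
    then show False using J by (auto simp: invariant_octic_def)
  qed
  then show ?thesis
    using P by (intro exI[of _ "2304 / J base_spinor"]) (auto simp: field_simps)
qed

lemma M_endo_factorization:
  assumes J: "invariant_octic J"
  shows "\<exists>c. c \<noteq> 0 \<and> (\<forall>z\<in>half_spin. M_endo z \<circ> M_endo z = (\<lambda>v. (c * J z) *s v))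
    \<and> matrix_factorization 14 M_mat M_mat (\<lambda>z. c * J z)"
proof -
  obtain c where c: "c \<noteq> 0" "\<And>z. z \<in> half_spin \<Longrightarrow> octic z = c * J z"
    using invariant_octic_unique[OF J] by blast
  have sp: "z \<in> spinors" if "z \<in> half_spin" for z using that half_spin_subset_spinors by blast
  have "M_endo z \<circ> M_endo z = (\<lambda>v. (c * J z) *s v)" if "z \<in> half_spin" for z
    using M_endo_square[OF sp[OF that] defect_zero[OF that]] c(2)[OF that] by (simp add: comp_def)
  moreover have "M_mat z * M_mat z = (c * J z) \<cdot>\<^sub>m 1\<^sub>m 14" if "z \<in> half_spin" for z
    using M_mat_square[OF sp[OF that] defect_zero[OF that]] c(2)[OF that] by simp
  moreover have "polynomial_on_half_spin (\<lambda>z. c * J z)"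
    using J unfolding invariant_octic_def by (blast intro: homogeneous_imp_polynomial homogeneous_cmult)
  moreover have "M_mat z \<in> carrier_mat 14 14" for z by (simp add: M_mat_def)
  ultimately show ?thesis
    using c(1) homogeneous_M_mat[THEN homogeneous_imp_polynomial]
    unfolding matrix_factorization_def by blast
qed

end

theorem theorem2p3p2:
  fixes scale :: "complex \<Rightarrow> 'v::ab_group_add \<Rightarrow> 'v"
    and q :: "'v \<Rightarrow> 'v \<Rightarrow> complex"
    and e f :: "nat \<Rightarrow> 'v"
  assumes "split_quadratic_space_14 scale q e f"
  defines "M \<equiv> split_quadratic_space_14.M_endo scale q e f"
    and "M_matrix \<equiv> split_quadratic_space_14.M_mat scale q e f"
    and "is_J8 \<equiv> split_quadratic_space_14.invariant_octic q e f"
  shows "(\<exists>J. is_J8 J)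
    \<and> (\<forall>i<14. \<forall>j<14. homogeneous_on_half_spin 4 (\<lambda>z. M_matrix z $$ (i, j)))
    \<and> (\<forall>J. is_J8 J \<longrightarrow>
         (\<exists>c. c \<noteq> 0
            \<and> (\<forall>z\<in>half_spin. M z \<circ> M z = (\<lambda>v. scale (c * J z) v))
            \<and> matrix_factorization 14 M_matrix M_matrix (\<lambda>z. c * J z)))"
proof -
  interpret split_quadratic_space_14 scale q e f by fact
  show ?thesis
    unfolding M_def M_matrix_def is_J8_def
    using invariant_octic_octic homogeneous_M_mat M_endo_factorization by blast
qed

end
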